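(* For $v_1,\ldots,v_p\in X$ and $M,N\in\bigwedge X$, $$v_{1\cdots p}\lrcorner(M\wedge N)=\sum_{\mathbf i\in\mathcal I^p}\epsilon_{\mathbf i\mathbf i'}\,\big(v_{\mathbf i'}\lrcorner M^{\wedge|\mathbf i|}\big)\wedge(v_{\mathbf i}\lrcorner N),$$ and $$v_{1\cdots p}\wedge(M\lrcorner N)=\sum_{\mathbf i\in\mathcal I^p}\epsilon_{\mathbf i\mathbf i'}\,\big(M^{\wedge|\mathbf i'|}\llcorner v_{\mathbf i}\big)\lrcorner(v_{\mathbf i'}\wedge N),$$ where $M^{\wedge k}$ denotes the result of applying the grade involution $k$ times to $M$ (not an exterior power).
   Context: $X$ is a finite-dimensional Euclidean (real) or Hermitian (complex) vector space with inner product $\langle\cdot,\cdot\rangle$, conjugate-linear in the left entry in the complex case. $\bigwedge X$ is its exterior algebra, with inner product given by $\langle v_1\wedge\cdots\wedge v_p,w_1\wedge\cdots\wedge w_p\rangle=\det(\langle v_i,w_j\rangle)$, with distinct $\bigwedge^pX$'s orthogonal, $\langle\kappa,\lambda\rangle=\bar\kappa\lambda$ for scalars, extended (sesqui)linearly. For $M,N\in\bigwedge X$, the left contraction $M\lrcorner N$ and right contraction $N\llcorner M$ are the unique elements of $\bigwedge X$ with $\langle L,M\lrcorner N\rangle=\langle M\wedge L,N\rangle$ and $\langle L,N\llcorner M\rangle=\langle L\wedge M,N\rangle$ for all $L\in\bigwedge X$. Grade involution: the linear map with $\hat M=(-1)^kM$ for $M\in\bigwedge^kX$. $M^{\wedge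 k}$ is the composition of $k$ grade involutions applied to $M$ (so it is $M$ for $k$ even and $\hat M$ for $k$ odd). Multi-indices: $\mathcal I^p$ is the set of all strictly increasing tuples $\mathbf i=(i_1,\dots,i_k)$, $0\le k\le p$, with entries in $\{1,\dots,p\}$ (including the empty tuple $\emptyset$); $|\mathbf i|=k$; $\mathbf i'$ is the increasing tuple of the elements of $\{1,\dots,p\}$ not in $\mathbf i$; $\mathbf i\mathbf i'$ is the concatenation, and $\epsilon_{\mathbf i\mathbf i'}$ is the sign of the permutation that puts it in increasing order. $v_{\mathbf i}=v_{i_1}\wedge\cdots\wedge v_{i_k}$, $v_\emptyset=1$, and $v_{1\cdots p}=v_1\wedge\cdots\wedge v_p$. *)

theory Defs
  imports
    "HOL-Analysis.Euclidean_Space"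
    "HOL-Library.Poly_Mapping"
    "HOL-Combinatorics.List_Permutation"
    "Jordan_Normal_Form.Determinant"
begin

section \<open>Euclidean and Hermitian spaces\<close>

text \<open>The library class \<^class>\<open>euclidean_space\<close> excludes the zero space, hence this weaker class.\<close>

class fin_dim_real_inner = real_inner +
  assumes real_fin_dim: "\<exists>B. finite B \<and> (\<forall>x. \<exists>c. x = (\<Sum>b\<in>B. c b *\<^sub>R b))"

subclass (in euclidean_space) fin_dim_real_inner
proof
  show "\<exists>B::'a set. finite B \<and> (\<forall>x. \<exists>c. x = (\<Sum>b\<in>B. c b *\<^sub>R b))"
    by (intro exI[of _ Basis] conjI allI exI[of _ "\<lambda>b. inner _ b"])
      (simp_all add: euclidean_representation)
qed

class hermitian_space = ab_group_add +
  fixes scaleC :: "complex \<Rightarrow> 'a \<Rightarrow> 'a" (infixr \<open>*\<^sub>C\<close> 75)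
    and cinner :: "'a \<Rightarrow> 'a \<Rightarrow> complex"
  assumes scaleC_add_right: "a *\<^sub>C (x + y) = a *\<^sub>C x + a *\<^sub>C y"
    and scaleC_add_left: "(a + b) *\<^sub>C x = a *\<^sub>C x + b *\<^sub>C x"
    and scaleC_scaleC: "a *\<^sub>C b *\<^sub>C x = (a * b) *\<^sub>C x"
    and scaleC_one: "1 *\<^sub>C x = x"
    and cinner_add_right: "cinner x (y + z) = cinner x y + cinner x z"
    and cinner_scaleC_right: "cinner x (a *\<^sub>C y) = a * cinner x y"
    and cinner_commute: "cinner y x = cnj (cinner x y)"
    and cinner_pos: "x \<noteq> 0 \<Longrightarrow> 0 < Re (cinner x x)"
    and complex_fin_dim: "\<exists>B. finite B \<and> (\<forall>x. \<exists>c. x = (\<Sum>b\<in>B. c b *\<^sub>C b))"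

lemma cinner_scaleC_left: "cinner (a *\<^sub>C x) y = cnj a * cinner x y"
  for x y :: "'a::hermitian_space"
  by (subst (1 2) cinner_commute) (simp add: cinner_scaleC_right)

instantiation complex :: hermitian_space
begin
definition scaleC_complex :: "complex \<Rightarrow> complex \<Rightarrow> complex"
  where "scaleC_complex a x = a * x"
definition cinner_complex :: "complex \<Rightarrow> complex \<Rightarrow> complex"
  where "cinner_complex x y = cnj x * y"
instance
proof
  show "x \<noteq> 0 \<Longrightarrow> 0 < Re (cinner x x)" for x :: complex
    by (auto simp: cinner_complex_def complex_eq_iff sum_squares_gt_zero_iff)
  show "\<exists>B::complex set. finite B \<and> (\<forall>x. \<exists>c. x = (\<Sum>b\<in>B. c b *\<^sub>C b))"
    by (intro exI[of _ "{1}"] conjI allI exI[of _ "\<lambda>_. _"]) (simp_all add: scaleC_complex_def)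
qed (simp_all add: scaleC_complex_def cinner_complex_def algebra_simps)
end


section \<open>The tensor algebra modulo squares of vectors\<close>

text \<open>Words over \<open>'v\<close>, as a monoid under concatenation; \<open>'v list \<Rightarrow>\<^sub>0 'k\<close> is then the
  free unital associative \<open>'k\<close>-algebra on the set \<open>'v\<close>.\<close>

instantiation list :: (type) monoid_add
begin
definition zero_list :: "'a list" where "zero_list = []"
definition plus_list :: "'a list \<Rightarrow> 'a list \<Rightarrow> 'a list" where "plus_list = (@)"
instance by standard (simp_all add: zero_list_def plus_list_def)
end

abbreviation letter :: "'v \<Rightarrow> 'v list \<Rightarrow>\<^sub>0 'k::comm_ring_1"
  where "letter x \<equiv> Poly_Mapping.single [x] 1"

abbreviation scalar :: "'k \<Rightarrow> 'v list \<Rightarrow>\<^sub>0 'k::comm_ring_1"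
  where "scalar c \<equiv> Poly_Mapping.single [] c"

lemma scalar_one: "scalar 1 = 1"
  by (metis single_one zero_list_def)

text \<open>The two-sided ideal of the free algebra generated by the linearity relations, whose
  quotient is the tensor algebra, together with all squares of vectors.\<close>

inductive ext_ideal :: "('k \<Rightarrow> 'v \<Rightarrow> 'v) \<Rightarrow> ('v::plus list \<Rightarrow>\<^sub>0 'k::comm_ring_1) \<Rightarrow> bool"
  for sm where
  zero: "ext_ideal sm 0"
| add: "ext_ideal sm f \<Longrightarrow> ext_ideal sm g \<Longrightarrow> ext_ideal sm (f + g)"
| linear: "ext_ideal sm
    (a * (letter (sm c x + y) - (scalar c * letter x + letter y)) * b)"
| square: "ext_ideal sm (a * (letter x * letter x) * b)"

definition ext_eq ::
    "('k \<Rightarrow> 'v \<Rightarrow> 'v) \<Rightarrow> ('v::plus list \<Rightarrow>\<^sub>0 'k::comm_ring_1) \<Rightarrow> ('v list \<Rightarrow>\<^sub>0 'k) \<Rightarrow> bool"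
  where "ext_eq sm f g \<longleftrightarrow> ext_ideal sm (f - g)"

lemma ext_ideal_mult_left: "ext_ideal sm f \<Longrightarrow> ext_ideal sm (h * f)"
proof (induction rule: ext_ideal.induct)
  case (linear a c x y b)
  show ?case using ext_ideal.linear[of sm "h * a" c x y b] by (simp only: mult.assoc)
next
  case (square a x b)
  show ?case using ext_ideal.square[of sm "h * a" x b] by (simp only: mult.assoc)
qed (auto simp: distrib_left intro: ext_ideal.intros)

lemma ext_ideal_mult_right: "ext_ideal sm f \<Longrightarrow> ext_ideal sm (f * h)"
proof (induction rule: ext_ideal.induct)
  case (linear a c x y b)
  show ?case using ext_ideal.linear[of sm a c x y "b * h"] by (simp only: mult.assoc)
next
  case (square a x b)
  show ?case using ext_ideal.square[of sm a x "b * h"] by (simp only: mult.assoc)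
qed (auto simp: distrib_right intro: ext_ideal.intros)

lemma ext_ideal_uminus: "ext_ideal sm f \<Longrightarrow> ext_ideal sm (- f)"
  using ext_ideal_mult_left[of sm f "- 1"] by simp

lemma ext_ideal_diff:
  "ext_ideal sm f \<Longrightarrow> ext_ideal sm g \<Longrightarrow> ext_ideal sm (f - g)"
  using ext_ideal.add[of sm f "- g"] ext_ideal_uminus[of sm g] by simp

lemma ext_eq_equivp: "equivp (ext_eq sm)"
proof (rule equivpI)
  show "reflp (ext_eq sm)"
    by (auto intro!: reflpI simp: ext_eq_def ext_ideal.zero)
  show "symp (ext_eq sm)"
    unfolding ext_eq_def by (rule sympI) (metis ext_ideal_uminus minus_diff_eq)
  show "transp (ext_eq sm)"
    unfolding ext_eq_def
    by (rule transpI) (metis ext_ideal.add diff_add_cancel add_diff_eq)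
qed

lemma ext_eq_add:
  "ext_eq sm f f' \<Longrightarrow> ext_eq sm g g' \<Longrightarrow> ext_eq sm (f + g) (f' + g')"
  unfolding ext_eq_def by (metis add_diff_add ext_ideal.add)

lemma ext_eq_uminus: "ext_eq sm f f' \<Longrightarrow> ext_eq sm (- f) (- f')"
  unfolding ext_eq_def by (metis ext_ideal_uminus minus_diff_minus)

lemma ext_eq_diff:
  "ext_eq sm f f' \<Longrightarrow> ext_eq sm g g' \<Longrightarrow> ext_eq sm (f - g) (f' - g')"
  using ext_eq_add[of sm f f' "- g" "- g'"] ext_eq_uminus[of sm g g'] by simp

lemma ext_eq_linear: "ext_eq sm (letter (sm c x + y)) (scalar c * letter x + letter y)"
  using ext_ideal.linear[of sm 1 c x y 1] by (simp add: ext_eq_def)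

lemma ext_eq_square: "ext_eq sm (letter x * letter x) 0"
  using ext_ideal.square[of sm 1 x 1] by (simp add: ext_eq_def)

lemma ext_eq_mult:
  assumes "ext_eq sm f f'" "ext_eq sm g g'"
  shows "ext_eq sm (f * g) (f' * g')"
proof -
  have "f * g - f' * g' = (f - f') * g + f' * (g - g')"
    by (simp add: algebra_simps)
  then show ?thesis
    using assms unfolding ext_eq_def
    by (simp only: ext_ideal.add ext_ideal_mult_left ext_ideal_mult_right)
qed

lemma free_algebra_induct [case_names zero add single]:
  assumes "P 0" "\<And>f g. P f \<Longrightarrow> P g \<Longrightarrow> P (f + g)" "\<And>w c. P (Poly_Mapping.single w c)"
  shows "P (f :: 'a \<Rightarrow>\<^sub>0 'k::comm_ring_1)"
proof (induction f rule: update_induct)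
  case (update f a b)
  have "Poly_Mapping.update a b f = f + Poly_Mapping.single a b"
    using update(1)
    by (intro poly_mapping_eqI)
      (auto simp: lookup_update lookup_add lookup_single in_keys_iff when_def)
  then show ?case using update assms by simp
qed (rule assms)


section \<open>Grade involution\<close>

lift_definition word_involution :: "('v list \<Rightarrow>\<^sub>0 'k::comm_ring_1) \<Rightarrow> ('v list \<Rightarrow>\<^sub>0 'k)"
  is "\<lambda>f w. (- 1) ^ length w * f w"
  by (erule finite_subset[rotated]) auto

lemma word_involution_single:
  "word_involution (Poly_Mapping.single w c) = Poly_Mapping.single w ((- 1) ^ length w * c)"
  by transfer (auto simp: fun_eq_iff when_def)

lemma word_involution_add: "word_involution (f + g) = word_involution f + word_involution g"
  by transfer (simp add: fun_eq_iff distrib_left)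

lemma word_involution_zero: "word_involution 0 = 0"
  by transfer simp

lemma word_involution_uminus: "word_involution (- f) = - word_involution f"
  by transfer (simp add: fun_eq_iff)

lemma word_involution_diff: "word_involution (f - g) = word_involution f - word_involution g"
  by transfer (simp add: fun_eq_iff right_diff_distrib)

lemma word_involution_mult: "word_involution (f * g) = word_involution f * word_involution g"
proof (induction f rule: free_algebra_induct)
  case (single w c)
  show ?case
    by (induction g rule: free_algebra_induct)
      (simp_all add: word_involution_zero word_involution_add distrib_left
        word_involution_single mult_single plus_list_def power_add mult_ac)
qed (simp_all add: word_involution_zero word_involution_add distrib_right)

lemma word_involution_ideal: "ext_ideal sm f \<Longrightarrow> ext_ideal sm (word_involution f)"
proof (induction rule: ext_ideal.induct)
  case (linear a c x y b)
  show ?case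
    using ext_ideal_uminus[OF ext_ideal.linear
        [of sm "word_involution a" c x y "word_involution b"]]
    by (simp add: word_involution_mult word_involution_diff word_involution_add
        word_involution_single single_uminus algebra_simps)
next
  case (square a x b)
  show ?case
    using ext_ideal.square[of sm "word_involution a" x "word_involution b"]
    by (simp add: word_involution_mult word_involution_single single_uminus)
qed (simp_all add: word_involution_zero word_involution_add ext_ideal.intros)


section \<open>The inner product\<close>

definition gram_det :: "('v \<Rightarrow> 'v \<Rightarrow> 'k::comm_ring_1) \<Rightarrow> 'v list \<Rightarrow> 'v list \<Rightarrow> 'k"
  where "gram_det ip u w =
    (if length u = length w
     then det (mat (length u) (length u) (\<lambda>(i, j). ip (u ! i) (w ! j))) else 0)"

text \<open>The extension of \<^const>\<open>gram_det\<close> from words to the free algebra, semilinear with respect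
  to \<open>cj\<close> in the left entry and linear in the right entry.\<close>

definition gram :: "('k \<Rightarrow> 'k) \<Rightarrow> ('v \<Rightarrow> 'v \<Rightarrow> 'k::comm_ring_1) \<Rightarrow>
    ('v list \<Rightarrow>\<^sub>0 'k) \<Rightarrow> ('v list \<Rightarrow>\<^sub>0 'k) \<Rightarrow> 'k"
  where "gram cj ip f g =
    (\<Sum>u\<in>Poly_Mapping.keys f. \<Sum>w\<in>Poly_Mapping.keys g.
       cj (Poly_Mapping.lookup f u) * Poly_Mapping.lookup g w * gram_det ip u w)"

locale sesquilinear =
  fixes sm :: "'k::comm_ring_1 \<Rightarrow> 'v::ab_group_add \<Rightarrow> 'v"
    and ip :: "'v \<Rightarrow> 'v \<Rightarrow> 'k" and cj :: "'k \<Rightarrow> 'k"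
  assumes ip_add: "ip x (y + z) = ip x y + ip x z"
    and ip_scale: "ip x (sm a y) = a * ip x y"
    and ip_commute: "ip y x = cj (ip x y)"
    and cj_add: "cj (a + b) = cj a + cj b"
    and cj_mult: "cj (a * b) = cj a * cj b"
    and cj_one: "cj 1 = 1"
    and cj_cj: "cj (cj a) = a"
begin

lemma cj_zero: "cj 0 = 0"
  using cj_add[of 0 0] by simp

lemma cj_uminus: "cj (- a) = - cj a"
  using cj_add[of a "- a"] cj_zero by (simp add: eq_neg_iff_add_eq_0 add.commute)

lemma cj_sum: "cj (sum h A) = (\<Sum>x\<in>A. cj (h x))"
  by (induction A rule: infinite_finite_induct) (auto simp: cj_zero cj_add)

lemma cj_prod: "cj (prod h A) = (\<Prod>x\<in>A. cj (h x))"
  by (induction A rule: infinite_finite_induct) (auto simp: cj_one cj_mult)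

lemma cj_signof: "cj (signof p) = signof p"
  by (auto simp: sign_def cj_one cj_uminus)

lemma ip_left: "ip (sm a x + y) z = cj a * ip x z + ip y z"
  by (metis ip_commute ip_add ip_scale cj_add cj_mult)

lemma gram_det_commute: "gram_det ip w u = cj (gram_det ip u w)"
proof (cases "length u = length w")
  case True
  let ?n = "length u"
  let ?A = "mat ?n ?n (\<lambda>(i, j). ip (u ! i) (w ! j))"
  let ?B = "mat ?n ?n (\<lambda>(i, j). ip (w ! i) (u ! j))"
  have B: "?B = map_mat cj (transpose_mat ?A)"
    by (rule eq_matI) (auto intro: ip_commute)
  have "det ?B = cj (det (transpose_mat ?A))"
    unfolding B by (subst (1 2) det_def'[of _ ?n])
      (auto simp: cj_sum cj_mult cj_prod cj_signof permutes_in_image intro!: sum.cong prod.cong)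
  then show ?thesis
    using True det_transpose[of ?A ?n] by (simp add: gram_det_def)
qed (simp add: gram_det_def cj_zero)

lemma gram_det_linear:
  "gram_det ip (u @ (sm c x + y) # w) z =
     cj c * gram_det ip (u @ x # w) z + gram_det ip (u @ y # w) z"
proof (cases "length z = length u + length w + 1")
  case True
  let ?n = "length z" and ?k = "length u"
  have split: "(\<Prod>i\<in>{0..<?n}. ip ((u @ t # w) ! i) (z ! p i)) =
      ip t (z ! p ?k) * (\<Prod>i\<in>{0..<?n} - {?k}. ip ((u @ x # w) ! i) (z ! p i))" for t p
  proof -
    have "(\<Prod>i\<in>{0..<?n} - {?k}. ip ((u @ t # w) ! i) (z ! p i)) =
        (\<Prod>i\<in>{0..<?n} - {?k}. ip ((u @ x # w) ! i) (z ! p i))"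
      by (rule prod.cong) (auto simp: nth_append nth_Cons split: nat.split)
    then show ?thesis
      using True by (subst prod.remove[of _ ?k]) auto
  qed
  have det: "gram_det ip (u @ t # w) z = (\<Sum>p | p permutes {0..<?n}.
      signof p * (\<Prod>i\<in>{0..<?n}. ip ((u @ t # w) ! i) (z ! p i)))" for t
    using True unfolding gram_det_def
    by (subst det_def'[of _ ?n]) (auto simp: permutes_in_image intro!: sum.cong prod.cong)
  show ?thesis
    unfolding det split
    by (simp add: ip_left sum_distrib_left sum.distrib[symmetric] distrib_left distrib_right mult_ac)
qed (auto simp: gram_det_def)

lemma gram_det_square: "gram_det ip (u @ x # x # w) z = 0"
proof (cases "length z = length u + length w + 2")
  case True
  let ?n = "length z"
  let ?A = "mat ?n ?n (\<lambda>(i, j). ip ((u @ x # x # w) ! i) (z ! j))"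
  have "det ?A = 0"
    using True by (intro det_identical_rows[of ?A ?n "length u" "Suc (length u)"])
      (auto intro!: eq_vecI simp: nth_append)
  then show ?thesis using True by (simp add: gram_det_def)
qed (auto simp: gram_det_def)

lemma gram_supersets:
  assumes "finite S" "finite T" "Poly_Mapping.keys f \<subseteq> S" "Poly_Mapping.keys g \<subseteq> T"
  shows "gram cj ip f g = (\<Sum>u\<in>S. \<Sum>w\<in>T.
       cj (Poly_Mapping.lookup f u) * Poly_Mapping.lookup g w * gram_det ip u w)"
proof -
  have "gram cj ip f g = (\<Sum>u\<in>Poly_Mapping.keys f. \<Sum>w\<in>T.
       cj (Poly_Mapping.lookup f u) * Poly_Mapping.lookup g w * gram_det ip u w)"
    unfolding gram_def using assms
    by (intro sum.cong sum.mono_neutral_left) (auto simp: in_keys_iff)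
  also have "\<dots> = (\<Sum>u\<in>S. \<Sum>w\<in>T.
       cj (Poly_Mapping.lookup f u) * Poly_Mapping.lookup g w * gram_det ip u w)"
    using assms by (intro sum.mono_neutral_left) (auto simp: in_keys_iff cj_zero)
  finally show ?thesis .
qed

lemma gram_commute: "gram cj ip g f = cj (gram cj ip f g)"
  unfolding gram_def
  by (subst sum.swap) (simp add: cj_sum cj_mult cj_cj gram_det_commute[symmetric] mult_ac)

lemma gram_add_left: "gram cj ip (f + f') g = gram cj ip f g + gram cj ip f' g"
proof -
  let ?S = "Poly_Mapping.keys f \<union> Poly_Mapping.keys f'" and ?T = "Poly_Mapping.keys g"
  have "Poly_Mapping.keys (f + f') \<subseteq> ?S" by (rule keys_add)
  then show ?thesis
    by (simp add: gram_supersets[of ?S ?T] lookup_add cj_add sum.distrib distrib_right)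
qed

lemma gram_add_right: "gram cj ip f (g + g') = gram cj ip f g + gram cj ip f g'"
  by (metis gram_commute gram_add_left cj_add)

lemma gram_zero_left: "gram cj ip 0 g = 0"
  by (simp add: gram_def)

lemma gram_zero_right: "gram cj ip f 0 = 0"
  by (simp add: gram_def)

lemma gram_diff_left: "gram cj ip (f - f') g = gram cj ip f g - gram cj ip f' g"
  using gram_add_left[of "f - f'" f' g] by simp

lemma gram_diff_right: "gram cj ip f (g - g') = gram cj ip f g - gram cj ip f g'"
  using gram_add_right[of f "g - g'" g'] by simp

lemma gram_single:
  "gram cj ip (Poly_Mapping.single u a) (Poly_Mapping.single w b) = cj a * b * gram_det ip u w"
  by (simp add: gram_def cj_zero)

lemma gram_linear:
  "gram cj ip (a * (letter (sm c x + y) - (scalar c * letter x + letter y)) * b) g = 0"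
proof (induction a rule: free_algebra_induct)
  case (single u d)
  show ?case
  proof (induction b rule: free_algebra_induct)
    case (single w e)
    show ?case
    proof (induction g rule: free_algebra_induct)
      case (single z r)
      show ?case
        by (simp add: mult_single plus_list_def left_diff_distrib right_diff_distrib
            distrib_left distrib_right gram_diff_left gram_add_left gram_single
            gram_det_linear cj_mult cj_one mult_ac)
    qed (simp_all add: gram_zero_right gram_add_right)
  qed (simp_all add: gram_zero_left gram_add_left distrib_left)
qed (simp_all add: gram_zero_left gram_add_left distrib_right)

lemma gram_square: "gram cj ip (a * (letter x * letter x) * b) g = 0"
proof (induction a rule: free_algebra_induct)
  case (single u d)
  show ?case
  proof (induction b rule: free_algebra_induct)
    case (single w e)
    show ?case
    proof (induction g rule: free_algebra_induct)
      case (single z r)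
      show ?case
        by (simp add: mult_single plus_list_def gram_single gram_det_square)
    qed (simp_all add: gram_zero_right gram_add_right)
  qed (simp_all add: gram_zero_left gram_add_left distrib_left)
qed (simp_all add: gram_zero_left gram_add_left distrib_right)

lemma gram_ideal: "ext_ideal sm f \<Longrightarrow> gram cj ip f g = 0"
  by (induction rule: ext_ideal.induct)
    (simp_all only: gram_zero_left gram_add_left gram_linear gram_square add_0)

lemma gram_ext_eq:
  assumes "ext_eq sm f f'" "ext_eq sm g g'"
  shows "gram cj ip f g = gram cj ip f' g'"
proof -
  have "gram cj ip f g = gram cj ip f' g"
    using gram_ideal[of "f - f'" g] assms(1) by (simp add: ext_eq_def gram_diff_left)
  also have "\<dots> = gram cj ip f' g'"
    using gram_ideal[of "g - g'" f'] assms(2) gram_commute[of "g - g'" f']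
    by (metis ext_eq_def gram_diff_right cj_cj cj_zero eq_iff_diff_eq_0)
  finally show ?thesis .
qed

lemma gram_scalar_right: "gram cj ip f (scalar c * g) = c * gram cj ip f g"
proof (induction g rule: free_algebra_induct)
  case (single w b)
  show ?case
    by (induction f rule: free_algebra_induct)
      (simp_all add: gram_zero_left gram_add_left distrib_left gram_single mult_single
        plus_list_def mult_ac)
qed (simp_all add: gram_zero_right gram_add_right distrib_left)

lemma one_not_ext_eq: "\<not> ext_eq sm 0 1"
proof
  assume "ext_eq sm 0 1"
  then have "gram cj ip 0 1 = gram cj ip 1 1"
    by (rule gram_ext_eq) (rule equivp_reflp[OF ext_eq_equivp])
  moreover have "gram cj ip 1 1 = 1"
    using gram_single[of "[]" 1 "[]" 1] by (simp add: cj_one gram_det_def scalar_one)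
  ultimately show False by (simp add: gram_zero_left)
qed

end

interpretation real_sesquilinear: sesquilinear scaleR inner id
  by standard (simp_all add: inner_add_right inner_commute)

interpretation complex_sesquilinear: sesquilinear scaleC cinner cnj
  by standard (simp_all add: cinner_add_right cinner_scaleC_right flip: cinner_commute)


section \<open>Exterior algebra of a real inner product space\<close>

text \<open>The ring multiplication \<open>*\<close> of the types \<open>real_ext\<close> and \<open>complex_ext\<close> is the
  exterior product.\<close>

quotient_type (overloaded) 'a real_ext = "'a::real_inner list \<Rightarrow>\<^sub>0 real" / "ext_eq scaleR"
  by (rule ext_eq_equivp)

instantiation real_ext :: (real_inner) ring_1
begin
lift_definition zero_real_ext :: "'a real_ext" is 0 .
lift_definition one_real_ext :: "'a real_ext" is 1 .
lift_definition plus_real_ext :: "'a real_ext \<Rightarrow> 'a real_ext \<Rightarrow> 'a real_ext" is "(+)"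
  by (rule ext_eq_add)
lift_definition uminus_real_ext :: "'a real_ext \<Rightarrow> 'a real_ext" is uminus
  by (rule ext_eq_uminus)
lift_definition minus_real_ext :: "'a real_ext \<Rightarrow> 'a real_ext \<Rightarrow> 'a real_ext" is "(-)"
  by (rule ext_eq_diff)
lift_definition times_real_ext :: "'a real_ext \<Rightarrow> 'a real_ext \<Rightarrow> 'a real_ext" is "(*)"
  by (rule ext_eq_mult)
instance
proof
  show "0 \<noteq> (1::'a real_ext)"
    by transfer (rule real_sesquilinear.one_not_ext_eq)
qed (transfer; simp add: algebra_simps ext_eq_equivp[THEN equivp_reflp])+
end

lift_definition real_ext_scalar :: "real \<Rightarrow> 'a::real_inner real_ext" is scalar .
lift_definition real_ext_vec :: "'a::real_inner \<Rightarrow> 'a real_ext" is letter .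

lift_definition real_ext_inner :: "'a::real_inner real_ext \<Rightarrow> 'a real_ext \<Rightarrow> real"
  is "gram id inner"
  by (rule real_sesquilinear.gram_ext_eq)

lift_definition real_ext_involution :: "'a::real_inner real_ext \<Rightarrow> 'a real_ext"
  is word_involution
  unfolding ext_eq_def by (metis word_involution_ideal word_involution_diff)

lemma real_ext_vec_linear:
  "real_ext_vec (scaleR c x + y) = real_ext_scalar c * real_ext_vec x + real_ext_vec y"
  by transfer (rule ext_eq_linear)

lemma real_ext_vec_square: "real_ext_vec x * real_ext_vec x = 0"
  by transfer (rule ext_eq_square)

lemma real_ext_scalar_mult: "real_ext_scalar (a * b) = real_ext_scalar a * real_ext_scalar b"
  by transfer (simp add: mult_single plus_list_def ext_eq_equivp[THEN equivp_reflp])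

lemma prod_list_real_ext_vec:
  "prod_list (map real_ext_vec xs) = abs_real_ext (Poly_Mapping.single xs 1)"
proof (induction xs)
  case Nil
  show ?case by (simp add: one_real_ext_def scalar_one)
next
  case (Cons x xs)
  then show ?case
    by (simp add: real_ext_vec.abs_eq times_real_ext.abs_eq mult_single plus_list_def)
qed

lemma real_ext_inner_prod_list:
  "real_ext_inner (prod_list (map real_ext_vec xs)) (prod_list (map real_ext_vec ys)) =
    (if length xs = length ys
     then det (mat (length xs) (length xs) (\<lambda>(i, j). inner (xs ! i) (ys ! j))) else 0)"
  by (simp add: prod_list_real_ext_vec real_ext_inner.abs_eq real_sesquilinear.gram_single
      gram_det_def)

lemma real_ext_inner_linear:
  "real_ext_inner L (real_ext_scalar c * M + N) = c * real_ext_inner L M + real_ext_inner L N"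
  by transfer (simp add: real_sesquilinear.gram_add_right real_sesquilinear.gram_scalar_right)

lemma real_ext_inner_commute: "real_ext_inner N M = real_ext_inner M N"
  by transfer (use real_sesquilinear.gram_commute in simp)

lemma real_ext_involution_mult:
  "real_ext_involution (M * N) = real_ext_involution M * real_ext_involution N"
  by transfer (simp add: word_involution_mult ext_eq_equivp[THEN equivp_reflp])

lemma real_ext_involution_prod_list:
  "real_ext_involution (real_ext_scalar c * prod_list (map real_ext_vec xs)) =
    (- 1) ^ length xs * (real_ext_scalar c * prod_list (map real_ext_vec xs))"
proof -
  have "real_ext_involution (real_ext_vec x) = - real_ext_vec x" for x :: 'a
    by transfer
      (simp add: word_involution_single single_uminus ext_eq_equivp[THEN equivp_reflp])
  moreover have "real_ext_involution (real_ext_scalar c) = (real_ext_scalar c :: 'a real_ext)"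
    by transfer (simp add: word_involution_single ext_eq_equivp[THEN equivp_reflp])
  moreover have "real_ext_involution 1 = (1 :: 'a real_ext)"
    by transfer
      (simp add: word_involution_single ext_eq_equivp[THEN equivp_reflp] flip: scalar_one)
  moreover have "(- 1) ^ n * (A * B) = A * ((- 1) ^ n * B)" for A B :: "'a real_ext" and n
    by (cases "even n") simp_all
  moreover have "real_ext_involution (prod_list (map real_ext_vec xs)) =
      (- 1) ^ length xs * prod_list (map real_ext_vec xs)"
    by (induction xs) (simp_all add: real_ext_involution_mult calculation)
  ultimately show ?thesis
    by (simp add: real_ext_involution_mult)
qed


section \<open>Exterior algebra of a Hermitian space\<close>

quotient_type (overloaded) 'a complex_ext = "'a::hermitian_space list \<Rightarrow>\<^sub>0 complex" / "ext_eq scaleC"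
  by (rule ext_eq_equivp)

instantiation complex_ext :: (hermitian_space) ring_1
begin
lift_definition zero_complex_ext :: "'a complex_ext" is 0 .
lift_definition one_complex_ext :: "'a complex_ext" is 1 .
lift_definition plus_complex_ext :: "'a complex_ext \<Rightarrow> 'a complex_ext \<Rightarrow> 'a complex_ext" is "(+)"
  by (rule ext_eq_add)
lift_definition uminus_complex_ext :: "'a complex_ext \<Rightarrow> 'a complex_ext" is uminus
  by (rule ext_eq_uminus)
lift_definition minus_complex_ext :: "'a complex_ext \<Rightarrow> 'a complex_ext \<Rightarrow> 'a complex_ext" is "(-)"
  by (rule ext_eq_diff)
lift_definition times_complex_ext :: "'a complex_ext \<Rightarrow> 'a complex_ext \<Rightarrow> 'a complex_ext" is "(*)"
  by (rule ext_eq_mult)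
instance
proof
  show "0 \<noteq> (1::'a complex_ext)"
    by transfer (rule complex_sesquilinear.one_not_ext_eq)
qed (transfer; simp add: algebra_simps ext_eq_equivp[THEN equivp_reflp])+
end

lift_definition complex_ext_scalar :: "complex \<Rightarrow> 'a::hermitian_space complex_ext" is scalar .
lift_definition complex_ext_vec :: "'a::hermitian_space \<Rightarrow> 'a complex_ext" is letter .

lift_definition complex_ext_inner :: "'a::hermitian_space complex_ext \<Rightarrow> 'a complex_ext \<Rightarrow> complex"
  is "gram cnj cinner"
  by (rule complex_sesquilinear.gram_ext_eq)

lift_definition complex_ext_involution :: "'a::hermitian_space complex_ext \<Rightarrow> 'a complex_ext"
  is word_involution
  unfolding ext_eq_def by (metis word_involution_ideal word_involution_diff)

lemma complex_ext_vec_linear: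
  "complex_ext_vec (scaleC c x + y) = complex_ext_scalar c * complex_ext_vec x + complex_ext_vec y"
  by transfer (rule ext_eq_linear)

lemma complex_ext_vec_square: "complex_ext_vec x * complex_ext_vec x = 0"
  by transfer (rule ext_eq_square)

lemma complex_ext_scalar_mult: "complex_ext_scalar (a * b) = complex_ext_scalar a * complex_ext_scalar b"
  by transfer (simp add: mult_single plus_list_def ext_eq_equivp[THEN equivp_reflp])

lemma prod_list_complex_ext_vec:
  "prod_list (map complex_ext_vec xs) = abs_complex_ext (Poly_Mapping.single xs 1)"
proof (induction xs)
  case Nil
  show ?case by (simp add: one_complex_ext_def scalar_one)
next
  case (Cons x xs)
  then show ?case
    by (simp add: complex_ext_vec.abs_eq times_complex_ext.abs_eq mult_single plus_list_def)
qed

lemma complex_ext_inner_prod_list: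
  "complex_ext_inner (prod_list (map complex_ext_vec xs)) (prod_list (map complex_ext_vec ys)) =
    (if length xs = length ys
     then det (mat (length xs) (length xs) (\<lambda>(i, j). cinner (xs ! i) (ys ! j))) else 0)"
  by (simp add: prod_list_complex_ext_vec complex_ext_inner.abs_eq complex_sesquilinear.gram_single
      gram_det_def)

lemma complex_ext_inner_linear:
  "complex_ext_inner L (complex_ext_scalar c * M + N) = c * complex_ext_inner L M + complex_ext_inner L N"
  by transfer (simp add: complex_sesquilinear.gram_add_right complex_sesquilinear.gram_scalar_right)

lemma complex_ext_inner_commute: "complex_ext_inner N M = cnj (complex_ext_inner M N)"
  by transfer (rule complex_sesquilinear.gram_commute)

lemma complex_ext_involution_mult:
  "complex_ext_involution (M * N) = complex_ext_involution M * complex_ext_involution N"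
  by transfer (simp add: word_involution_mult ext_eq_equivp[THEN equivp_reflp])

lemma complex_ext_involution_prod_list:
  "complex_ext_involution (complex_ext_scalar c * prod_list (map complex_ext_vec xs)) =
    (- 1) ^ length xs * (complex_ext_scalar c * prod_list (map complex_ext_vec xs))"
proof -
  have "complex_ext_involution (complex_ext_vec x) = - complex_ext_vec x" for x :: 'a
    by transfer
      (simp add: word_involution_single single_uminus ext_eq_equivp[THEN equivp_reflp])
  moreover have "complex_ext_involution (complex_ext_scalar c) = (complex_ext_scalar c :: 'a complex_ext)"
    by transfer (simp add: word_involution_single ext_eq_equivp[THEN equivp_reflp])
  moreover have "complex_ext_involution 1 = (1 :: 'a complex_ext)"
    by transfer
      (simp add: word_involution_single ext_eq_equivp[THEN equivp_reflp] flip: scalar_one)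
  moreover have "(- 1) ^ n * (A * B) = A * ((- 1) ^ n * B)" for A B :: "'a complex_ext" and n
    by (cases "even n") simp_all
  moreover have "complex_ext_involution (prod_list (map complex_ext_vec xs)) =
      (- 1) ^ length xs * prod_list (map complex_ext_vec xs)"
    by (induction xs) (simp_all add: complex_ext_involution_mult calculation)
  ultimately show ?thesis
    by (simp add: complex_ext_involution_mult)
qed


section \<open>Contractions and multi-indices\<close>

text \<open>In both contractions the first multivector argument is the one on the left of the
  contraction sign.\<close>

definition left_contraction :: "('e \<Rightarrow> 'e \<Rightarrow> 'k) \<Rightarrow> 'e \<Rightarrow> 'e \<Rightarrow> 'e::times"
  where "left_contraction ip M N = (THE P. \<forall>L. ip L P = ip (M * L) N)"

definition right_contraction :: "('e \<Rightarrow> 'e \<Rightarrow> 'k) \<Rightarrow> 'e \<Rightarrow> 'e \<Rightarrow> 'e::times"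
  where "right_contraction ip N M = (THE P. \<forall>L. ip L P = ip (L * M) N)"

definition blade :: "('v \<Rightarrow> 'e::ring_1) \<Rightarrow> (nat \<Rightarrow> 'v) \<Rightarrow> nat list \<Rightarrow> 'e"
  where "blade emb v is = prod_list (map (\<lambda>i. emb (v i)) is)"

definition multi_indices :: "nat \<Rightarrow> nat list set"
  where "multi_indices p = {is. sorted_wrt (<) is \<and> set is \<subseteq> {1..p}}"

definition co_index :: "nat \<Rightarrow> nat list \<Rightarrow> nat list"
  where "co_index p is = sorted_list_of_set ({1..p} - set is)"

text \<open>Only used for lists without repetitions, for which the sorting permutation is unique.\<close>

definition sorting_sign :: "nat list \<Rightarrow> int"
  where "sorting_sign xs =
    sign (THE \<pi>. \<pi> permutes {..<length xs} \<and> sorted (permute_list \<pi> xs))"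

end

theory Submission
  imports Defs
begin

text \<open>Contraction by a vector is a graded derivation of the exterior algebra, and both identities are its
Leibniz rule, iterated over \<open>v\<^sub>1, \<dots>, v\<^sub>p\<close>.

Write \<open>\<delta> x\<close> for the left contraction by a vector \<open>x\<close>, that is, for the adjoint of left
multiplication by \<open>x\<close>, write \<open>hat\<close> for the grade involution and \<open>*\<close> for the exterior product. The
Leibniz rule is \<open>\<delta> x (M * N) = \<delta> x M * N + hat M * \<delta> x N\<close>. Contraction by
\<open>v\<^sub>1 * \<dots> * v\<^sub>p\<close> applies \<open>\<delta> v\<^sub>1, \<dots>, \<delta> v\<^sub>p\<close> in this order. Going from \<open>p\<close> to
\<open>p + 1\<close>, each term for a multi-index \<open>i\<close> with complement \<open>i'\<close> splits in two: \<open>p + 1\<close> joins either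
\<open>i'\<close> or \<open>i\<close>. In the first case it is appended to \<open>i i'\<close>, and the sign does not change. In the
second case it must be moved past all of \<open>i'\<close>. The resulting sign, \<open>- 1\<close> to the power \<open>length i'\<close>, is
the one that appears when \<open>hat\<close> is pulled through the \<open>length i'\<close> contractions already applied to \<open>M\<close>.
This is \<open>lc_blade_mult\<close>.

Taking adjoints in the Leibniz rule gives the case \<open>p = 1\<close> of the second identity, \<open>emb_mult_lc\<close>:
the product of \<open>x\<close> with the contraction of \<open>N\<close> by \<open>M\<close> is the sum of the contraction of \<open>N\<close> by
\<open>hat (\<delta> x M)\<close>, which is the right contraction of \<open>M\<close> by \<open>x\<close>, and of the contraction of \<open>x * N\<close>
by \<open>hat M\<close>. The same splitting of multi-indices then gives \<open>blade_mult_lc\<close>.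

What remains is that contractions exist and are determined by their adjunction property. Existence comes
from a formula: \<open>\<delta> x\<close> removes each letter of a word in turn, with alternating signs, and its
adjointness is the Laplace expansion of the Gram determinant (\<open>gram_free_contraction\<close>). Uniqueness is
nondegeneracy of the inner product (\<open>gram_nondegenerate\<close>). For an orthogonal basis \<open>B\<close> of the space of
vectors, the Euler operator, the sum over \<open>b\<close> in \<open>B\<close> of the maps
\<open>M \<mapsto> b * \<delta> b M\<close> divided by the squared length of \<open>b\<close>, multiplies elements of grade \<open>k\<close>
by \<open>k\<close>. If an element of grade \<open>k > 0\<close> is orthogonal to everything, so are its contractions
\<open>\<delta> b M\<close>, which have smaller grade and hence vanish by induction; so the element itself vanishes.

The analysis of the inner product takes place in the free algebra, modulo the exterior relations, for a
sesquilinear form that covers the real and the complex case. The two identities are proved from a short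
list of properties, which is then verified for both quotients.\<close>

section \<open>The free algebra modulo the exterior relations\<close>

lemma scalar_commute: "scalar c * f = f * (scalar c :: 'w list \<Rightarrow>\<^sub>0 'k::comm_ring_1)"
  by (induction f rule: free_algebra_induct)
    (simp_all add: distrib_left distrib_right mult_single plus_list_def mult.commute)

lemma scalar_mult: "scalar (a * b) = scalar a * (scalar b :: 'w list \<Rightarrow>\<^sub>0 'k::comm_ring_1)"
  by (simp add: mult_single plus_list_def)

lemma single_Cons: "Poly_Mapping.single (y # w) (1::'k::comm_ring_1) = letter y * Poly_Mapping.single w 1"
  by (simp add: mult_single plus_list_def)

lemma single_scalar: "Poly_Mapping.single w (c::'k::comm_ring_1) = scalar c * Poly_Mapping.single w 1"
  by (simp add: mult_single plus_list_def)

lemma word_involution_one: "word_involution 1 = (1 :: 'w list \<Rightarrow>\<^sub>0 'k::comm_ring_1)"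
  using word_involution_single[of "[]" "1::'k"] by (simp add: scalar_one)

lemma word_involution_involution: "word_involution (word_involution f) = f"
  by transfer (simp add: fun_eq_iff mult.assoc[symmetric] power_add[symmetric])

lemma ext_eq_refl: "ext_eq sm f f"
  by (rule equivp_reflp[OF ext_eq_equivp])

lemma ext_eq_sym: "ext_eq sm f g \<Longrightarrow> ext_eq sm g f"
  by (rule equivp_symp[OF ext_eq_equivp])

lemma ext_eq_trans [trans]: "ext_eq sm f g \<Longrightarrow> ext_eq sm g h \<Longrightarrow> ext_eq sm f h"
  by (rule equivp_transp[OF ext_eq_equivp])

lemma ext_eq_sum:
  "(\<And>a. a \<in> A \<Longrightarrow> ext_eq sm (f a) (g a)) \<Longrightarrow> ext_eq sm (sum f A) (sum g A)"
  by (induction A rule: infinite_finite_induct) (auto simp: ext_eq_refl ext_eq_add)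

text \<open>Polarisation of the relation that squares of vectors vanish.\<close>

lemma ext_eq_letter_swap:
  fixes sm :: "'k::comm_ring_1 \<Rightarrow> 'v::ab_group_add \<Rightarrow> 'v"
  shows "ext_eq sm (letter x * letter y) (- (letter y * letter x))"
proof -
  let ?z = "sm 1 x + y"
  have "ext_eq sm (letter ?z) (letter x + letter y)"
    using ext_eq_linear[of sm 1 x y] by (simp add: scalar_one)
  then have "ext_eq sm (letter ?z * letter ?z) ((letter x + letter y) * (letter x + letter y))"
    by (intro ext_eq_mult)
  then have "ext_eq sm 0 ((letter x + letter y) * (letter x + letter y))"
    using ext_eq_square ext_eq_sym ext_eq_trans by blast
  then have "ext_ideal sm ((letter x + letter y) * (letter x + letter y))"
    using ext_ideal_uminus[of sm "0 - (letter x + letter y) * (letter x + letter y)"]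
    by (simp add: ext_eq_def)
  then have "ext_ideal sm ((letter x + letter y) * (letter x + letter y)
      - letter x * letter x - letter y * letter y)"
    using ext_eq_square[of sm x] ext_eq_square[of sm y] by (simp add: ext_eq_def ext_ideal_diff)
  then show ?thesis by (simp add: ext_eq_def algebra_simps)
qed

text \<open>Moving a vector past a word of length \<open>n\<close> costs \<open>n\<close> transpositions of letters.\<close>

lemma ext_eq_letter_commute:
  fixes sm :: "'k::comm_ring_1 \<Rightarrow> 'v::ab_group_add \<Rightarrow> 'v"
  shows "ext_eq sm (letter x * f) (word_involution f * letter x)"
proof (induction f rule: free_algebra_induct)
  case (single w c)
  have word: "ext_eq sm (letter x * Poly_Mapping.single w 1)
      (word_involution (Poly_Mapping.single w 1) * letter x)"
  proof (induction w)
    case Nil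
    show ?case by (simp add: scalar_one word_involution_one ext_eq_refl)
  next
    case (Cons y w)
    have inv: "word_involution (letter y) = - (letter y :: 'v list \<Rightarrow>\<^sub>0 'k)"
      by (simp add: word_involution_single single_uminus)
    let ?w = "Poly_Mapping.single w (1::'k)"
    have "ext_eq sm (letter x * letter y * ?w) (- (letter y * letter x) * ?w)"
      by (intro ext_eq_mult ext_eq_letter_swap ext_eq_refl)
    also have "- (letter y * letter x) * ?w = - letter y * (letter x * ?w)"
      by (simp add: mult.assoc)
    also have "ext_eq sm \<dots> (- letter y * (word_involution ?w * letter x))"
      by (intro ext_eq_mult ext_eq_refl Cons.IH)
    finally show ?case
      unfolding single_Cons[of y w] by (simp only: word_involution_mult inv mult.assoc)
  qed
  have "ext_eq sm (scalar c * (letter x * Poly_Mapping.single w 1))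
      (scalar c * (word_involution (Poly_Mapping.single w 1) * letter x))"
    by (intro ext_eq_mult ext_eq_refl word)
  also have "scalar c * (letter x * Poly_Mapping.single w 1) = letter x * Poly_Mapping.single w c"
    by (simp add: mult_single plus_list_def)
  also have "scalar c * (word_involution (Poly_Mapping.single w 1) * letter x) =
      word_involution (Poly_Mapping.single w c) * letter x"
    by (simp add: word_involution_single mult_single plus_list_def mult.commute)
  finally show ?case .
qed (simp_all add: word_involution_zero word_involution_add distrib_left distrib_right
    ext_eq_refl ext_eq_add)

text \<open>The homogeneous component of degree \<open>k\<close>, used to split an element of the radical of the inner product
into parts on which the Euler operator is a scalar.\<close>

lift_definition word_grade :: "nat \<Rightarrow> ('v list \<Rightarrow>\<^sub>0 'k::zero) \<Rightarrow> ('v list \<Rightarrow>\<^sub>0 'k)"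
  is "\<lambda>k f w. if length w = k then f w else 0"
  by (erule finite_subset[rotated]) auto

lemma word_grade_zero: "word_grade k 0 = 0"
  by transfer auto

lemma word_grade_add: "word_grade k (f + g) = word_grade k f + word_grade k g"
  by transfer auto

lemma word_grade_sum: "word_grade k (sum h A) = (\<Sum>a\<in>A. word_grade k (h a))"
  by (induction A rule: infinite_finite_induct) (auto simp: word_grade_zero word_grade_add)

lemma word_grade_single:
  "word_grade k (Poly_Mapping.single w c) = (if length w = k then Poly_Mapping.single w c else 0)"
  by transfer (auto simp: fun_eq_iff when_def)

lemma word_grade_scalar_mult:
  "word_grade k (scalar c * f) = scalar c * word_grade k f"
  by (induction f rule: free_algebra_induct)
    (auto simp: word_grade_zero word_grade_add word_grade_single mult_single plus_list_def
      distrib_left)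

lemma sum_word_grade: "\<exists>n. (\<Sum>k<n. word_grade k f) = (f :: 'v list \<Rightarrow>\<^sub>0 'k::comm_ring_1)"
proof -
  obtain n where n: "\<forall>w\<in>Poly_Mapping.keys f. length w < n"
    using finite_nat_set_iff_bounded[of "length ` Poly_Mapping.keys f"] by auto
  have "(\<Sum>k<n. word_grade k f) = f"
  proof (rule poly_mapping_eqI)
    fix w
    have "Poly_Mapping.lookup (\<Sum>k<n. word_grade k f) w =
        (\<Sum>k<n. if length w = k then Poly_Mapping.lookup f w else 0)"
      by (simp add: lookup_sum word_grade.rep_eq)
    also have "\<dots> = Poly_Mapping.lookup f w"
      using n by (auto simp: in_keys_iff)
    finally show "Poly_Mapping.lookup (\<Sum>k<n. word_grade k f) w = Poly_Mapping.lookup f w" .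
  qed
  then show ?thesis ..
qed

section \<open>Contraction by a vector\<close>

context sesquilinear
begin

definition word_contraction :: "'v \<Rightarrow> 'v list \<Rightarrow> ('v list \<Rightarrow>\<^sub>0 'k)"
  where "word_contraction x w = (\<Sum>j<length w.
    Poly_Mapping.single (take j w @ drop (Suc j) w) ((- 1) ^ j * ip x (w ! j)))"

definition free_contraction :: "'v \<Rightarrow> ('v list \<Rightarrow>\<^sub>0 'k) \<Rightarrow> ('v list \<Rightarrow>\<^sub>0 'k)"
  where "free_contraction x f =
    (\<Sum>w\<in>Poly_Mapping.keys f. scalar (Poly_Mapping.lookup f w) * word_contraction x w)"

lemma word_contraction_Nil: "word_contraction x [] = 0"
  by (simp add: word_contraction_def)

lemma word_contraction_Cons:
  "word_contraction x (y # w) =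
    scalar (ip x y) * Poly_Mapping.single w 1 - letter y * word_contraction x w"
  unfolding word_contraction_def
  by (simp add: sum.lessThan_Suc_shift sum_distrib_left mult_single plus_list_def single_uminus
      sum_negf del: sum.lessThan_Suc)

lemma free_contraction_superset:
  assumes "finite S" "Poly_Mapping.keys f \<subseteq> S"
  shows "free_contraction x f =
    (\<Sum>w\<in>S. scalar (Poly_Mapping.lookup f w) * word_contraction x w)"
  unfolding free_contraction_def using assms
  by (intro sum.mono_neutral_left) (auto simp: in_keys_iff)

lemma free_contraction_zero: "free_contraction x 0 = 0"
  by (simp add: free_contraction_def)

lemma free_contraction_add:
  "free_contraction x (f + g) = free_contraction x f + free_contraction x g"
proof -
  let ?S = "Poly_Mapping.keys f \<union> Poly_Mapping.keys g"
  have "Poly_Mapping.keys (f + g) \<subseteq> ?S" by (rule keys_add)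
  then show ?thesis
    by (simp add: free_contraction_superset[of ?S] lookup_add single_add distrib_right
        sum.distrib)
qed

lemma free_contraction_single:
  "free_contraction x (Poly_Mapping.single w c) = scalar c * word_contraction x w"
  by (simp add: free_contraction_def)

lemma free_contraction_diff:
  "free_contraction x (f - g) = free_contraction x f - free_contraction x g"
  using free_contraction_add[of x "f - g" g] by simp

lemma free_contraction_scalar_mult:
  "free_contraction x (scalar c * f) = scalar c * free_contraction x f"
proof (induction f rule: free_algebra_induct)
  case (single w d)
  have "scalar c * Poly_Mapping.single w d = Poly_Mapping.single w (c * d)"
    by (simp add: mult_single plus_list_def)
  then show ?case
    by (simp only: free_contraction_single scalar_mult mult.assoc)
qed (simp_all add: free_contraction_zero free_contraction_add distrib_left)

lemma free_contraction_letter_mult: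
  "free_contraction x (letter y * f) = scalar (ip x y) * f - letter y * free_contraction x f"
proof (induction f rule: free_algebra_induct)
  case (single w d)
  have "free_contraction x (letter y * Poly_Mapping.single w d) =
      scalar d * word_contraction x (y # w)"
    by (simp add: mult_single plus_list_def free_contraction_single)
  also have "\<dots> = scalar d * (scalar (ip x y) * Poly_Mapping.single w 1) -
      letter y * (scalar d * word_contraction x w)"
    by (simp add: word_contraction_Cons right_diff_distrib
        scalar_commute[of d "letter y"] mult.assoc[symmetric])
  finally show ?case
    by (simp add: mult_single plus_list_def free_contraction_single mult.commute)
qed (simp_all add: free_contraction_zero free_contraction_add distrib_left)

text \<open>Each letter of \<open>f\<close> that the contraction passes contributes a sign; together these signs form the
grade involution.\<close>

lemma free_contraction_mult:
  "free_contraction x (f * g) =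
    free_contraction x f * g + word_involution f * free_contraction x g"
proof (induction f rule: free_algebra_induct)
  case (single w c)
  have word: "free_contraction x (Poly_Mapping.single w 1 * g) =
      free_contraction x (Poly_Mapping.single w 1) * g +
      word_involution (Poly_Mapping.single w 1) * free_contraction x g"
  proof (induction w)
    case Nil
    have "free_contraction x (Poly_Mapping.single [] 1) = 0"
      by (simp add: free_contraction_single word_contraction_Nil)
    then show ?case by (simp add: scalar_one word_involution_one)
  next
    case (Cons y w)
    have inv: "word_involution (letter y) = - (letter y :: 'v list \<Rightarrow>\<^sub>0 'k)"
      by (simp add: word_involution_single single_uminus)
    show ?case
      by (simp only: single_Cons[of y w] mult.assoc free_contraction_letter_mult Cons.IH
          word_involution_mult inv)
        (simp add: algebra_simps)
  qed
  show ?case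
    unfolding single_scalar[of w c] mult.assoc free_contraction_scalar_mult word
    by (simp add: word_involution_mult word_involution_single distrib_left mult.assoc)
qed (simp_all add: free_contraction_zero free_contraction_add word_involution_zero
    word_involution_add algebra_simps)

text \<open>By the Leibniz rule it is enough that the contraction kills the generators of the ideal: a linearity
relation because \<open>ip x\<close> is linear, and \<open>y * y\<close> because its two terms
\<open>ip x y * y\<close> and \<open>- y * ip x y\<close> cancel.\<close>

lemma free_contraction_ideal: "ext_ideal sm f \<Longrightarrow> ext_ideal sm (free_contraction x f)"
proof (induction rule: ext_ideal.induct)
  case zero
  show ?case by (simp add: free_contraction_zero ext_ideal.zero)
next
  case (add f g)
  then show ?case by (simp add: free_contraction_add ext_ideal.add)
next
  case (linear a c y z b)
  let ?r = "letter (sm c y + z) - (scalar c * letter y + letter z)"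
  have r: "ext_ideal sm ?r"
    using ext_ideal.linear[of sm 1 c y z 1] by simp
  have ip: "ip x (sm c y + z) = c * ip x y + ip x z"
    by (simp add: ip_add ip_scale)
  have "free_contraction x ?r = 0"
    by (simp add: free_contraction_diff free_contraction_add free_contraction_scalar_mult
        free_contraction_single word_contraction_def ip mult_single plus_list_def single_add
        distrib_left)
  then show ?case
    unfolding free_contraction_mult[of x "a * ?r" b] free_contraction_mult[of x a ?r]
    by (simp only: mult_zero_right add_0_right word_involution_mult)
      (intro ext_ideal.add ext_ideal_mult_left ext_ideal_mult_right word_involution_ideal r)
next
  case (square a y b)
  let ?r = "letter y * letter y"
  have r: "ext_ideal sm ?r"
    using ext_ideal.square[of sm 1 y 1] by simp
  have "free_contraction x ?r = 0"
    by (simp add: free_contraction_letter_mult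
        free_contraction_single word_contraction_def mult_single plus_list_def scalar_one
        single_uminus)
  then show ?case
    unfolding free_contraction_mult[of x "a * ?r" b] free_contraction_mult[of x a ?r]
    by (simp only: mult_zero_right add_0_right word_involution_mult[of a])
      (intro ext_ideal.add ext_ideal_mult_left ext_ideal_mult_right word_involution_ideal r)
qed

lemma free_contraction_ext_eq:
  "ext_eq sm f g \<Longrightarrow> ext_eq sm (free_contraction x f) (free_contraction x g)"
  using free_contraction_ideal[of "f - g" x] by (simp add: ext_eq_def free_contraction_diff)

lemma gram_det_Cons_left:
  assumes "length w = Suc (length u)"
  shows "gram_det ip (x # u) w =
    (\<Sum>j<length w. (- 1) ^ j * ip x (w ! j) * gram_det ip u (take j w @ drop (Suc j) w))"
proof -
  let ?n = "length w"
  let ?A = "mat ?n ?n (\<lambda>(i, j). ip ((x # u) ! i) (w ! j))"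
  have "gram_det ip (x # u) w = (\<Sum>j<?n. ?A $$ (0, j) * cofactor ?A 0 j)"
    using assms laplace_expansion_row[of ?A ?n 0] by (simp add: gram_det_def)
  also have "\<dots> = (\<Sum>j<?n. (- 1) ^ j * ip x (w ! j) * gram_det ip u (take j w @ drop (Suc j) w))"
  proof (rule sum.cong[OF refl])
    fix j assume "j \<in> {..<?n}"
    then have j: "j < ?n" by simp
    have "mat_delete ?A 0 j = mat (length u) (length u)
        (\<lambda>(i, k). ip (u ! i) ((take j w @ drop (Suc j) w) ! k))"
      using assms j by (intro eq_matI) (auto simp: mat_delete_def nth_append min_def)
    then show "?A $$ (0, j) * cofactor ?A 0 j =
        (- 1) ^ j * ip x (w ! j) * gram_det ip u (take j w @ drop (Suc j) w)"
      using assms j by (simp add: gram_det_def cofactor_def min_def)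
  qed
  finally show ?thesis .
qed

lemma gram_sum_right: "gram cj ip f (sum h A) = (\<Sum>a\<in>A. gram cj ip f (h a))"
  by (induction A rule: infinite_finite_induct) (auto simp: gram_zero_right gram_add_right)

text \<open>The signed removal of letters in \<^const>\<open>word_contraction\<close> is exactly what the Laplace expansion
produces, so the contraction is adjoint to exterior multiplication by \<open>x\<close> on the left.\<close>

lemma gram_free_contraction:
  "gram cj ip f (free_contraction x g) = gram cj ip (letter x * f) g"
proof (induction f rule: free_algebra_induct)
  case (single u c)
  show ?case
  proof (induction g rule: free_algebra_induct)
    case (single w d)
    have "(\<Sum>j<length w. (- 1) ^ j * ip x (w ! j) * gram_det ip u (take j w @ drop (Suc j) w)) =
        gram_det ip (x # u) w"
    proof (cases "length w = Suc (length u)")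
      case False
      then have "gram_det ip u (take j w @ drop (Suc j) w) = 0" if "j < length w" for j
        using that by (auto simp: gram_det_def)
      then show ?thesis using False by (simp add: gram_det_def)
    qed (simp add: gram_det_Cons_left)
    then show ?case
      by (simp add: free_contraction_single gram_scalar_right word_contraction_def
          gram_sum_right gram_single mult_single plus_list_def)
        (simp add: sum_distrib_left mult_ac flip: sum_distrib_left)
  qed (simp_all add: free_contraction_zero free_contraction_add gram_zero_right gram_add_right)
qed (simp_all add: gram_zero_left gram_add_left distrib_left)

lemma gram_letter_mult:
  "gram cj ip f (letter x * g) = gram cj ip (free_contraction x f) g"
  by (metis gram_commute gram_free_contraction)

lemma gram_word_involution:
  "gram cj ip (word_involution f) g = gram cj ip f (word_involution g)"
proof (induction f rule: free_algebra_induct)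
  case (single u c)
  show ?case
  proof (induction g rule: free_algebra_induct)
    case (single w d)
    have "cj ((- 1) ^ n) = (- 1) ^ n" for n
      by (cases "even n") (simp_all add: cj_one cj_uminus)
    then show ?case
      by (cases "length u = length w")
        (auto simp: word_involution_single gram_single cj_mult gram_det_def)
  qed (simp_all add: word_involution_zero word_involution_add gram_zero_right gram_add_right)
qed (simp_all add: word_involution_zero word_involution_add gram_zero_left gram_add_left)

lemma gram_scalar_left: "gram cj ip (scalar c * f) g = gram cj ip f (scalar (cj c) * g)"
  by (metis gram_commute gram_scalar_right cj_mult cj_cj)

text \<open>Adjoints of left multiplication compose from those for scalars and letters, so they exist for every
\<open>m\<close>.\<close>

lemma gram_adjoint_exists: "\<exists>h. \<forall>f. gram cj ip f h = gram cj ip (m * f) g"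
proof (induction m rule: free_algebra_induct)
  case zero
  show ?case by (intro exI[of _ 0]) (simp add: gram_zero_left gram_zero_right)
next
  case (add m m')
  then obtain h h' where
    "\<forall>f. gram cj ip f h = gram cj ip (m * f) g" "\<forall>f. gram cj ip f h' = gram cj ip (m' * f) g"
    by blast
  then show ?case
    by (intro exI[of _ "h + h'"]) (simp add: gram_add_left gram_add_right distrib_right)
next
  case (single w c)
  have "\<exists>h. \<forall>f. gram cj ip f h = gram cj ip (Poly_Mapping.single w 1 * f) g'" for g'
  proof (induction w arbitrary: g')
    case Nil
    show ?case by (intro exI[of _ g']) (simp add: scalar_one)
  next
    case (Cons y w)
    obtain h where
      "\<forall>f. gram cj ip f h = gram cj ip (Poly_Mapping.single w 1 * f) (free_contraction y g')"
      using Cons by blast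
    then show ?case
      by (intro exI[of _ h]) (simp add: single_Cons[of y w] gram_free_contraction mult.assoc)
  qed
  from this[of "scalar (cj c) * g"] show ?case
    by (simp only: single_scalar[of w c] gram_scalar_left mult.assoc)
qed

lemma gram_word_grade: "gram cj ip f (word_grade k g) = gram cj ip (word_grade k f) g"
proof (induction f rule: free_algebra_induct)
  case (single u c)
  show ?case
    by (induction g rule: free_algebra_induct)
      (auto simp: word_grade_zero word_grade_add word_grade_single gram_zero_right gram_zero_left
        gram_add_right gram_single gram_det_def)
qed (simp_all add: word_grade_zero word_grade_add gram_zero_left gram_add_left)

lemma word_grade_word_contraction:
  "word_grade k (word_contraction x w) = (if length w = Suc k then word_contraction x w else 0)"
  unfolding word_contraction_def word_grade_sum word_grade_single
  by (auto simp del: sum.lessThan_Suc intro!: sum.cong sum.neutral)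

lemma free_contraction_word_grade:
  "free_contraction x (word_grade (Suc k) f) = word_grade k (free_contraction x f)"
  by (induction f rule: free_algebra_induct)
    (simp_all add: free_contraction_zero free_contraction_add word_grade_zero word_grade_add
      word_grade_single free_contraction_single word_grade_scalar_mult
      word_grade_word_contraction)

end

section \<open>Nondegeneracy of the inner product\<close>

text \<open>The real and the Hermitian case at once. Positivity enters through \<open>ip_self\<close>, which allows division by
\<open>ip x x\<close> in the Gram-Schmidt process.\<close>

locale anisotropic_form = sesquilinear sm ip cj + vector_space sm
  for sm :: "'k::field_char_0 \<Rightarrow> 'v::ab_group_add \<Rightarrow> 'v"
    and ip :: "'v \<Rightarrow> 'v \<Rightarrow> 'k" and cj :: "'k \<Rightarrow> 'k" +
  assumes ip_self: "x \<noteq> 0 \<Longrightarrow> ip x x \<noteq> 0"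
    and fin_dim: "\<exists>B. finite B \<and> (\<forall>x. \<exists>c. x = (\<Sum>b\<in>B. sm (c b) b))"
begin

lemma ip_zero_right: "ip x 0 = 0"
  using ip_add[of x 0 0] by simp

lemma ip_sum: "ip x (sum h A) = (\<Sum>a\<in>A. ip x (h a))"
  by (induction A rule: infinite_finite_induct) (auto simp: ip_zero_right ip_add)

lemma ip_orthogonal_sym: "ip x y = 0 \<Longrightarrow> ip y x = 0"
  by (metis ip_commute cj_zero)

text \<open>The Fourier expansion of \<open>x\<close>. For a finite orthogonal set \<open>B\<close> of nonzero vectors it says that \<open>x\<close>
lies in the span of \<open>B\<close>.\<close>

definition reproduces :: "'v set \<Rightarrow> 'v \<Rightarrow> bool"
  where "reproduces B x \<longleftrightarrow> (\<Sum>b\<in>B. sm (ip b x / ip b b) b) = x"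

lemma reproduces_sum:
  assumes "\<And>s. s \<in> S \<Longrightarrow> reproduces B s"
  shows "reproduces B (\<Sum>s\<in>S. sm (c s) s)"
proof -
  have "(\<Sum>b\<in>B. sm (ip b (\<Sum>s\<in>S. sm (c s) s) / ip b b) b) =
      (\<Sum>b\<in>B. \<Sum>s\<in>S. sm (c s) (sm (ip b s / ip b b) b))"
    unfolding ip_sum ip_scale sum_divide_distrib scale_sum_left by simp
  also have "\<dots> = (\<Sum>s\<in>S. sm (c s) (\<Sum>b\<in>B. sm (ip b s / ip b b) b))"
    by (subst sum.swap) (simp only: scale_sum_right)
  also have "\<dots> = (\<Sum>s\<in>S. sm (c s) s)"
    using assms by (intro sum.cong) (auto simp: reproduces_def)
  finally show ?thesis by (simp add: reproduces_def)
qed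

text \<open>Gram-Schmidt without normalisation: \<open>r\<close> is the part of the new vector \<open>y\<close> orthogonal to
the vectors found so far.\<close>

lemma orthogonal_set_exists:
  assumes "finite S"
  shows "\<exists>C. finite C \<and> 0 \<notin> C \<and> (\<forall>b\<in>C. \<forall>c\<in>C. b \<noteq> c \<longrightarrow> ip b c = 0) \<and>
    (\<forall>x\<in>S. reproduces C x)"
  using assms
proof (induction S rule: finite_induct)
  case empty
  show ?case by (intro exI[of _ "{}"]) simp
next
  case (insert y S)
  from insert.IH obtain C where IH: "finite C \<and> 0 \<notin> C \<and>
      (\<forall>b\<in>C. \<forall>c\<in>C. b \<noteq> c \<longrightarrow> ip b c = 0) \<and> (\<forall>x\<in>S. reproduces C x)" ..
  then have C: "finite C" "0 \<notin> C"
    and orth: "\<And>b c. b \<in> C \<Longrightarrow> c \<in> C \<Longrightarrow> b \<noteq> c \<Longrightarrow> ip b c = 0"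
    and repr: "\<And>x. x \<in> S \<Longrightarrow> reproduces C x"
    by simp_all
  define q where "q = (\<Sum>b\<in>C. sm (ip b y / ip b b) b)"
  define r where "r = y - q"
  have y: "q + r = y" by (simp add: r_def)
  have q: "ip b q = ip b y" if "b \<in> C" for b
  proof -
    have "b \<noteq> 0" using that C(2) by blast
    have "ip b q = (\<Sum>c\<in>C. ip c y / ip c c * ip b c)"
      by (simp add: q_def ip_sum ip_scale)
    also have "\<dots> = (\<Sum>c\<in>C. if c = b then ip b y else 0)"
      using that orth ip_self[OF \<open>b \<noteq> 0\<close>] by (intro sum.cong) auto
    finally show ?thesis using that C(1) by simp
  qed
  have r: "ip b r = 0" "ip r b = 0" if "b \<in> C" for b
    using q[OF that] ip_add[of b q r] ip_orthogonal_sym[of b r] by (auto simp: y)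
  show ?case
  proof (cases "r = 0")
    case True
    then have "reproduces C y" using y by (simp add: reproduces_def q_def)
    then show ?thesis using C orth repr by (intro exI[of _ C]) blast
  next
    case False
    have "r \<notin> C" using False r(1) ip_self by blast
    have "ip r q = 0" unfolding q_def ip_sum ip_scale by (simp add: r)
    then have "ip r y = ip r r" using ip_add[of r q r] by (simp add: y)
    then have "reproduces (insert r C) y"
      using \<open>r \<notin> C\<close> C(1) y ip_self[OF False]
      by (simp add: reproduces_def q_def add.commute)
    moreover have "reproduces (insert r C) x" if "x \<in> S" for x
    proof -
      have "ip r (\<Sum>b\<in>C. sm (ip b x / ip b b) b) = 0"
        by (simp add: ip_sum ip_scale r)
      then have "ip r x = 0" using repr[OF that] by (simp add: reproduces_def)
      then show ?thesis using \<open>r \<notin> C\<close> C(1) repr[OF that] by (simp add: reproduces_def)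
    qed
    ultimately show ?thesis
      using C orth r False by (intro exI[of _ "insert r C"]) auto
  qed
qed

lemma reproducing_set_exists: "\<exists>B. \<forall>x. reproduces B x"
proof -
  obtain S where S: "finite S" "\<And>x. \<exists>c. x = (\<Sum>b\<in>S. sm (c b) b)"
    using fin_dim by metis
  obtain C where "\<And>x. x \<in> S \<Longrightarrow> reproduces C x"
    using orthogonal_set_exists[OF S(1)] by blast
  then have "reproduces C x" for x
    using reproduces_sum S(2)[of x] by metis
  then show ?thesis by blast
qed

lemma ext_eq_letter_zero: "ext_eq sm (letter 0) 0"
proof -
  have "ext_eq sm (letter 0) (letter 0 + letter 0)"
    using ext_eq_linear[of sm 1 0 0] by (simp add: scalar_one)
  then show ?thesis
    unfolding ext_eq_def using ext_ideal_uminus by fastforce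
qed

lemma ext_eq_letter_sum:
  "ext_eq sm (letter (\<Sum>b\<in>B. sm (c b) b)) (\<Sum>b\<in>B. scalar (c b) * letter b)"
proof (induction B rule: infinite_finite_induct)
  case (insert b B)
  have "ext_eq sm (letter (sm (c b) b + (\<Sum>b\<in>B. sm (c b) b)))
      (scalar (c b) * letter b + letter (\<Sum>b\<in>B. sm (c b) b))"
    by (rule ext_eq_linear)
  also have "ext_eq sm \<dots> (scalar (c b) * letter b + (\<Sum>b\<in>B. scalar (c b) * letter b))"
    by (intro ext_eq_add ext_eq_refl insert)
  finally show ?case using insert.hyps by simp
qed (simp_all add: ext_eq_letter_zero)

text \<open>The name refers to \<open>\<Sum>i. x\<^sub>i * \<partial>\<^sub>i\<close> on polynomials, which also multiplies each
homogeneous element by its degree.\<close>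

definition euler :: "'v set \<Rightarrow> ('v list \<Rightarrow>\<^sub>0 'k) \<Rightarrow> ('v list \<Rightarrow>\<^sub>0 'k)"
  where "euler B f = (\<Sum>b\<in>B. scalar (1 / ip b b) * (letter b * free_contraction b f))"

text \<open>The contraction \<open>\<delta>\<^sub>b\<close> either meets the letter \<open>y\<close> or passes it. The terms of the first kind
reassemble \<open>y\<close> by its Fourier expansion. In the others \<open>b\<close> also has to move past \<open>y\<close>, which restores
the sign.\<close>

lemma euler_letter_mult:
  assumes "\<And>x. reproduces B x"
  shows "ext_eq sm (euler B (letter y * f)) (letter y * f + letter y * euler B f)"
proof -
  have expansion: "ext_eq sm (\<Sum>b\<in>B. scalar (ip b y / ip b b) * letter b) (letter y)"
    using ext_eq_sym[OF ext_eq_letter_sum[of "\<lambda>b. ip b y / ip b b" B]] assms[of y]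
    by (simp add: reproduces_def)
  have swap: "ext_eq sm (- (letter b * letter y)) (letter y * letter b)" for b
    using ext_eq_uminus[OF ext_eq_letter_swap[of sm b y]] by simp
  have summand: "ext_eq sm
      (scalar (1 / ip b b) * (letter b * free_contraction b (letter y * f)))
      (scalar (ip b y / ip b b) * letter b * f +
        letter y * (scalar (1 / ip b b) * (letter b * free_contraction b f)))" for b
  proof -
    have "scalar (1 / ip b b) * (letter b * free_contraction b (letter y * f)) =
        scalar (1 / ip b b) * (letter b * (scalar (ip b y) * f)) +
        scalar (1 / ip b b) * (- (letter b * letter y) * free_contraction b f)"
      by (simp add: free_contraction_letter_mult algebra_simps)
    also have "scalar (1 / ip b b) * (letter b * (scalar (ip b y) * f)) =
        scalar (ip b y / ip b b) * letter b * f"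
      by (simp add: mult_single plus_list_def flip: mult.assoc)
    also have "ext_eq sm (scalar (ip b y / ip b b) * letter b * f +
        scalar (1 / ip b b) * (- (letter b * letter y) * free_contraction b f))
       (scalar (ip b y / ip b b) * letter b * f +
        scalar (1 / ip b b) * (letter y * letter b * free_contraction b f))"
      by (intro ext_eq_add ext_eq_mult ext_eq_refl swap)
    also have "scalar (1 / ip b b) * (letter y * letter b * free_contraction b f) =
        letter y * (scalar (1 / ip b b) * (letter b * free_contraction b f))"
      by (simp add: scalar_commute[of _ "letter y"] flip: mult.assoc)
    finally show ?thesis .
  qed
  have "ext_eq sm (euler B (letter y * f))
      (\<Sum>b\<in>B. scalar (ip b y / ip b b) * letter b * f +
        letter y * (scalar (1 / ip b b) * (letter b * free_contraction b f)))"
    unfolding euler_def by (intro ext_eq_sum summand)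
  also have "\<dots> = (\<Sum>b\<in>B. scalar (ip b y / ip b b) * letter b) * f + letter y * euler B f"
    by (simp add: euler_def sum.distrib sum_distrib_left sum_distrib_right)
  also have "ext_eq sm \<dots> (letter y * f + letter y * euler B f)"
    by (intro ext_eq_add ext_eq_mult ext_eq_refl expansion)
  finally show ?thesis .
qed

lemma euler_word_grade:
  assumes "\<And>x. reproduces B x"
  shows "ext_eq sm (euler B (word_grade k f)) (scalar (of_nat k) * word_grade k f)"
proof (induction f rule: free_algebra_induct)
  case zero
  show ?case by (simp add: word_grade_zero euler_def free_contraction_zero ext_eq_refl)
next
  case (add f g)
  have "euler B (f + g) = euler B f + euler B g" for f g
    by (simp add: euler_def free_contraction_add distrib_left sum.distrib)
  with add show ?case by (simp add: word_grade_add distrib_left ext_eq_add)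
next
  case (single w c)
  have word: "ext_eq sm (euler B (Poly_Mapping.single w 1))
      (scalar (of_nat (length w)) * Poly_Mapping.single w 1)" for w
  proof (induction w)
    case Nil
    show ?case by (simp add: euler_def free_contraction_single word_contraction_Nil ext_eq_refl)
  next
    case (Cons y w)
    let ?w = "Poly_Mapping.single w (1::'k)"
    have "ext_eq sm (euler B (letter y * ?w)) (letter y * ?w + letter y * euler B ?w)"
      by (rule euler_letter_mult[OF assms])
    also have "ext_eq sm \<dots> (letter y * ?w + letter y * (scalar (of_nat (length w)) * ?w))"
      by (intro ext_eq_add ext_eq_mult ext_eq_refl Cons.IH)
    also have "\<dots> = scalar (of_nat (length (y # w))) * (letter y * ?w)"
      by (simp add: mult_single plus_list_def single_add[symmetric] add.commute)
    finally show ?case unfolding single_Cons[of y w] .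
  qed
  have "euler B (scalar c * f) = scalar c * euler B f" for f
    unfolding euler_def sum_distrib_left
    by (intro sum.cong refl)
      (simp add: free_contraction_scalar_mult mult.assoc[symmetric] mult_single plus_list_def
        mult.commute)
  then have "ext_eq sm (euler B (Poly_Mapping.single w c))
      (scalar c * (scalar (of_nat (length w)) * Poly_Mapping.single w 1))"
    by (simp only: single_scalar[of w c] ext_eq_mult[OF ext_eq_refl word])
  then have "ext_eq sm (euler B (Poly_Mapping.single w c))
      (scalar (of_nat (length w)) * Poly_Mapping.single w c)"
    by (simp add: mult_single plus_list_def mult.commute)
  moreover have "euler B 0 = 0" by (simp add: euler_def free_contraction_zero)
  ultimately show ?case by (auto simp: word_grade_single ext_eq_refl)
qed

text \<open>The radical is invariant under contractions, since these are adjoint to multiplications, and is the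
sum of its homogeneous parts, since different degrees are orthogonal. On a part of positive degree the
Euler operator is an invertible scalar, and it factors through contractions that vanish by induction on the
degree. In degree zero the form is the one on scalars.\<close>

lemma gram_nondegenerate:
  assumes "\<And>f. gram cj ip f g = 0"
  shows "ext_ideal sm g"
proof -
  obtain B where B: "\<And>x. reproduces B x"
    using reproducing_set_exists by blast
  have homogeneous: "ext_ideal sm (word_grade k g)" if "\<And>f. gram cj ip f g = 0" for k g
    using that
  proof (induction k arbitrary: g)
    case 0
    have "word_grade 0 g = scalar (Poly_Mapping.lookup g [])"
      by (rule poly_mapping_eqI) (auto simp: word_grade.rep_eq lookup_single when_def)
    moreover have "gram cj ip 1 (word_grade 0 g) = 0"
      using "0" by (simp add: gram_word_grade)
    ultimately show ?case
      using gram_single[of "[]" 1 "[]"]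
      by (simp add: scalar_one cj_one gram_det_def ext_ideal.zero)
  next
    case (Suc k)
    have "ext_ideal sm (free_contraction b (word_grade (Suc k) g))" for b
      unfolding free_contraction_word_grade
      using Suc.prems by (intro Suc.IH) (simp add: gram_free_contraction)
    then have "ext_eq sm (free_contraction b (word_grade (Suc k) g)) 0" for b
      by (simp add: ext_eq_def)
    then have "ext_eq sm (euler B (word_grade (Suc k) g))
        (\<Sum>b\<in>B. scalar (1 / ip b b) * (letter b * 0))"
      unfolding euler_def by (intro ext_eq_sum ext_eq_mult ext_eq_refl)
    then have "ext_eq sm (euler B (word_grade (Suc k) g)) 0"
      by simp
    from ext_eq_sym[OF this] have "ext_eq sm 0 (euler B (word_grade (Suc k) g))" .
    also note euler_word_grade[OF B]
    finally have "ext_eq sm 0 (scalar (of_nat (Suc k)) * word_grade (Suc k) g)" .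
    then have "ext_eq sm (scalar (1 / of_nat (Suc k)) * 0)
        (scalar (1 / of_nat (Suc k)) * (scalar (of_nat (Suc k)) * word_grade (Suc k) g))"
      by (intro ext_eq_mult ext_eq_refl)
    moreover have "scalar (1 / of_nat (Suc k)) * (scalar (of_nat (Suc k)) * word_grade (Suc k) g)
        = word_grade (Suc k) g"
      by (simp add: mult.assoc[symmetric] mult_single plus_list_def scalar_one del: of_nat_Suc)
    ultimately have "ext_eq sm 0 (word_grade (Suc k) g)"
      by simp
    from ext_eq_sym[OF this] show ?case by (simp add: ext_eq_def)
  qed
  obtain n where n: "(\<Sum>k<n. word_grade k g) = g" using sum_word_grade by blast
  have "ext_ideal sm (\<Sum>k<m. word_grade k g)" for m
    by (induction m) (simp_all add: homogeneous[OF assms] ext_ideal.zero ext_ideal.add)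
  from this[of n] show ?thesis by (simp add: n)
qed

end

section \<open>Signs of sorting permutations\<close>

lemma sorting_permutation_exists:
  fixes xs :: "nat list"
  obtains \<pi> where "\<pi> permutes {..<length xs}" "sorted (permute_list \<pi> xs)"
proof -
  obtain \<pi> where "\<pi> permutes {..<length xs}" "permute_list \<pi> xs = sort xs"
    using mset_eq_permutation[of "sort xs" xs] by auto
  then show thesis using that[of \<pi>] by simp
qed

text \<open>Without repeated entries the sorting permutation is unique, so any one of them computes the sign.\<close>

lemma sorting_sign_eq_sign:
  assumes "distinct xs" "\<pi> permutes {..<length xs}" "sorted (permute_list \<pi> xs)"
  shows "sorting_sign xs = sign \<pi>"
proof -
  have "\<sigma> = \<pi>" if \<sigma>: "\<sigma> permutes {..<length xs}" "sorted (permute_list \<sigma> xs)" for \<sigma>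
  proof
    fix k
    have "permute_list \<sigma> xs = permute_list \<pi> xs"
      using assms \<sigma> by (metis properties_for_sort mset_permute_list)
    then have *: "xs ! \<sigma> k = xs ! \<pi> k" if "k < length xs"
      using that assms(2) \<sigma>(1) by (metis permute_list_nth)
    show "\<sigma> k = \<pi> k"
    proof (cases "k < length xs")
      case True
      then have "\<sigma> k < length xs" "\<pi> k < length xs"
        using permutes_in_image[OF assms(2), of k] permutes_in_image[OF \<sigma>(1), of k] by auto
      then show ?thesis using *[OF True] nth_eq_iff_index_eq[OF assms(1)] by blast
    next
      case False
      then show ?thesis
        using permutes_not_in[OF assms(2), of k] permutes_not_in[OF \<sigma>(1), of k] by simp
    qed
  qed
  then have "(THE \<pi>. \<pi> permutes {..<length xs} \<and> sorted (permute_list \<pi> xs)) = \<pi>"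
    using assms by (intro the_equality) blast+
  then show ?thesis by (simp add: sorting_sign_def)
qed

lemma sorting_sign_swap:
  assumes "distinct (as @ a # b # bs)"
  shows "sorting_sign (as @ b # a # bs) = - sorting_sign (as @ a # b # bs)"
proof -
  let ?xs = "as @ a # b # bs" and ?ys = "as @ b # a # bs"
  let ?t = "Transposition.transpose (length as) (Suc (length as))"
  have t: "?t permutes {..<length ?xs}"
    by (intro permutes_swap_id) auto
  have ys: "?ys = permute_list ?t ?xs"
  proof (rule nth_equalityI)
    fix k assume "k < length ?ys"
    then have k: "k < length ?xs" by simp
    show "?ys ! k = permute_list ?t ?xs ! k"
      unfolding permute_list_nth[OF t k]
      by (auto simp: nth_append nth_Cons Transposition.transpose_def split: nat.splits)
  qed simp
  obtain \<pi> where \<pi>: "\<pi> permutes {..<length ?ys}" "sorted (permute_list \<pi> ?ys)"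
    by (rule sorting_permutation_exists)
  then have \<pi>': "\<pi> permutes {..<length ?xs}" by simp
  have "permute_list (?t \<circ> \<pi>) ?xs = permute_list \<pi> ?ys"
    unfolding ys by (rule permute_list_compose[OF \<pi>'])
  then have "sorting_sign ?xs = sign (?t \<circ> \<pi>)"
    using assms \<pi> permutes_compose[OF \<pi>' t] by (intro sorting_sign_eq_sign) auto
  also have "\<dots> = sign ?t * sign \<pi>"
    using t \<pi>' by (intro sign_compose) (auto intro: permutes_imp_permutation[rotated])
  also have "\<dots> = - sign \<pi>"
    by (simp add: sign_swap_id)
  also have "sign \<pi> = sorting_sign ?ys"
    using assms \<pi> by (intro sorting_sign_eq_sign[symmetric]) auto
  finally show ?thesis by simp
qed

lemma sorting_sign_snoc_max:
  assumes "distinct xs" "\<And>x. x \<in> set xs \<Longrightarrow> x < m"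
  shows "sorting_sign (xs @ [m]) = sorting_sign xs"
proof -
  obtain \<pi> where \<pi>: "\<pi> permutes {..<length xs}" "sorted (permute_list \<pi> xs)"
    by (rule sorting_permutation_exists)
  have \<pi>': "\<pi> permutes {..<length (xs @ [m])}"
    using \<pi>(1) by (rule permutes_subset) auto
  have "permute_list \<pi> (xs @ [m]) = permute_list \<pi> xs @ [m]"
  proof (rule nth_equalityI)
    fix k assume k: "k < length (permute_list \<pi> (xs @ [m]))"
    show "permute_list \<pi> (xs @ [m]) ! k = (permute_list \<pi> xs @ [m]) ! k"
    proof (cases "k < length xs")
      case True
      then show ?thesis
        using \<pi>(1) k permute_list_nth[OF \<pi>', of k] permutes_in_image[OF \<pi>(1), of k]
        by (simp add: nth_append permute_list_nth)
    next
      case False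
      then show ?thesis
        using k permute_list_nth[OF \<pi>', of k] permutes_not_in[OF \<pi>(1), of k]
        by (simp add: nth_append)
    qed
  qed simp
  then have "sorted (permute_list \<pi> (xs @ [m]))"
    using \<pi> assms(2) by (auto simp: sorted_append set_permute_list intro: less_imp_le)
  then have "sorting_sign (xs @ [m]) = sign \<pi>"
    using assms \<pi>' by (intro sorting_sign_eq_sign) auto
  then show ?thesis
    using sorting_sign_eq_sign[OF assms(1) \<pi>] by simp
qed

text \<open>Moving the maximum \<open>m\<close> to the end takes one adjacent transposition for each entry of \<open>ys\<close>.\<close>

lemma sorting_sign_insert_max:
  assumes "distinct (xs @ ys)" "\<And>x. x \<in> set (xs @ ys) \<Longrightarrow> x < m"
  shows "sorting_sign (xs @ m # ys) = (- 1) ^ length ys * sorting_sign (xs @ ys)"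
  using assms
proof (induction ys arbitrary: xs)
  case Nil
  then show ?case by (simp add: sorting_sign_snoc_max)
next
  case (Cons y ys)
  have "distinct (xs @ y # m # ys)" using Cons.prems by auto
  from sorting_sign_swap[OF this] show ?case
    using Cons.IH[of "xs @ [y]"] Cons.prems by simp
qed

section \<open>Multi-indices\<close>

lemma multi_indices_0: "multi_indices 0 = {[]}"
  by (auto simp: multi_indices_def)

lemma multi_indices_Suc:
  "multi_indices (Suc p) = multi_indices p \<union> (\<lambda>i. i @ [Suc p]) ` multi_indices p"
proof (intro equalityI subsetI)
  fix i assume i: "i \<in> multi_indices (Suc p)"
  show "i \<in> multi_indices p \<union> (\<lambda>i. i @ [Suc p]) ` multi_indices p"
  proof (cases i rule: rev_cases)
    case Nil
    then show ?thesis by (simp add: multi_indices_def)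
  next
    case (snoc j n)
    then have j: "sorted_wrt (<) j" "\<forall>k\<in>set j. k < n" "n \<le> Suc p" "\<forall>k\<in>set i. 1 \<le> k"
      using i by (auto simp: multi_indices_def sorted_wrt_append)
    show ?thesis
    proof (cases "n = Suc p")
      case True
      then have "j \<in> multi_indices p" using j snoc by (auto simp: multi_indices_def)
      then show ?thesis using snoc True by blast
    next
      case False
      then have "i \<in> multi_indices p"
        using i j snoc by (fastforce simp: multi_indices_def)
      then show ?thesis by blast
    qed
  qed
qed (auto simp: multi_indices_def sorted_wrt_append subset_iff less_Suc_eq_le)

lemma finite_multi_indices: "finite (multi_indices p)"
  by (induction p) (simp_all add: multi_indices_0 multi_indices_Suc)

lemma sum_multi_indices_Suc:
  "(\<Sum>i\<in>multi_indices (Suc p). f i) =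
    (\<Sum>i\<in>multi_indices p. f i) + (\<Sum>i\<in>multi_indices p. f (i @ [Suc p]))"
proof -
  have "multi_indices p \<inter> (\<lambda>i. i @ [Suc p]) ` multi_indices p = {}"
    by (auto simp: multi_indices_def)
  then have "(\<Sum>i\<in>multi_indices (Suc p). f i) =
      (\<Sum>i\<in>multi_indices p. f i) + (\<Sum>i\<in>(\<lambda>i. i @ [Suc p]) ` multi_indices p. f i)"
    unfolding multi_indices_Suc by (intro sum.union_disjoint) (auto simp: finite_multi_indices)
  then show ?thesis
    by (simp add: sum.reindex inj_on_def)
qed

lemma co_index_Suc:
  assumes "i \<in> multi_indices p"
  shows "co_index (Suc p) i = co_index p i @ [Suc p]"
proof -
  have "{1..Suc p} - set i = insert (Suc p) ({1..p} - set i)"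
    using assms by (auto simp: multi_indices_def)
  moreover have "sorted_list_of_set (insert (Suc p) ({1..p} - set i)) =
      sorted_list_of_set ({1..p} - set i) @ [Suc p]"
    using sorted_insort_is_snoc[of "sorted_list_of_set ({1..p} - set i)" "Suc p"] by simp
  ultimately show ?thesis by (simp add: co_index_def)
qed

lemma co_index_Suc_snoc:
  assumes "i \<in> multi_indices p"
  shows "co_index (Suc p) (i @ [Suc p]) = co_index p i"
proof -
  have "{1..Suc p} - set (i @ [Suc p]) = {1..p} - set i"
    by auto
  then show ?thesis by (simp add: co_index_def)
qed

lemma index_co_index_distinct_less:
  assumes "i \<in> multi_indices p"
  shows "distinct (i @ co_index p i)" "x \<in> set (i @ co_index p i) \<Longrightarrow> x < Suc p"
  using assms
  by (auto simp: multi_indices_def strict_sorted_iff co_index_def)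

lemma sorting_sign_co_index_Suc:
  assumes "i \<in> multi_indices p"
  shows "sorting_sign (i @ co_index (Suc p) i) = sorting_sign (i @ co_index p i)"
  using sorting_sign_snoc_max[OF index_co_index_distinct_less[OF assms]]
  by (simp add: co_index_Suc[OF assms])

lemma sorting_sign_co_index_Suc_snoc:
  assumes "i \<in> multi_indices p"
  shows "sorting_sign ((i @ [Suc p]) @ co_index (Suc p) (i @ [Suc p])) =
    (- 1) ^ length (co_index p i) * sorting_sign (i @ co_index p i)"
  using sorting_sign_insert_max[OF index_co_index_distinct_less[OF assms]]
  by (simp add: co_index_Suc_snoc[OF assms])

section \<open>The two identities for an abstract exterior algebra\<close>

text \<open>The coefficients in both identities are integers, and these pass through every additive map. In the
Hermitian case contraction is only conjugate-linear in its first argument, so that plain linearity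
could not be used there.\<close>

lemma additive_of_int_mult:
  fixes f :: "'e::ring_1 \<Rightarrow> 'd::ring_1"
  assumes "additive f"
  shows "f (of_int k * x) = of_int k * f x"
proof (induction k rule: int_induct[where k = 0])
  case (step1 k)
  then show ?case by (simp add: distrib_right additive.add[OF assms])
next
  case (step2 k)
  then show ?case by (simp add: left_diff_distrib additive.diff[OF assms])
qed (simp add: additive.zero[OF assms])

lemma additive_power_neg_one_mult:
  fixes f :: "'e::ring_1 \<Rightarrow> 'd::ring_1"
  assumes "additive f"
  shows "f ((- 1) ^ n * x) = (- 1) ^ n * f x"
  using additive_of_int_mult[OF assms, of "(- 1) ^ n" x] by simp

lemma power_neg_one_commute: "(- 1) ^ n * (x::'e::ring_1) = x * (- 1) ^ n"
  by (cases "even n") simp_all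

text \<open>What the proof uses of an exterior algebra with inner product \<open>ip\<close>, grade involution \<open>hat\<close>, inclusion
of vectors \<open>emb\<close> and contraction by vectors \<open>ctr\<close>. The two adjunctions \<open>ip_ctr\<close> and \<open>ip_emb_mult\<close> are
the two sides of one statement about a Hermitian form; with both as assumptions, real and complex
scalars can be treated alike.\<close>

locale exterior_contraction =
  fixes ip :: "'e::ring_1 \<Rightarrow> 'e \<Rightarrow> 'k::ring_1" and hat :: "'e \<Rightarrow> 'e"
    and emb :: "'v \<Rightarrow> 'e" and ctr :: "'v \<Rightarrow> 'e \<Rightarrow> 'e"
  assumes ip_add_left: "ip (K + L) N = ip K N + ip L N"
    and ip_add_right: "ip L (M + N) = ip L M + ip L N"
    and nondegenerate: "(\<And>L. ip L N = 0) \<Longrightarrow> N = 0"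
    and adjoint_exists: "\<exists>P. \<forall>L. ip L P = ip (M * L) N"
    and hat_add: "hat (M + N) = hat M + hat N"
    and hat_mult: "hat (M * N) = hat M * hat N"
    and hat_hat: "hat (hat M) = M"
    and hat_emb: "hat (emb x) = - emb x"
    and ip_hat: "ip (hat L) N = ip L (hat N)"
    and emb_commute: "emb x * L = hat L * emb x"
    and ip_ctr: "ip L (ctr x N) = ip (emb x * L) N"
    and ip_emb_mult: "ip L (emb x * N) = ip (ctr x L) N"
    and ctr_add: "ctr x (M + N) = ctr x M + ctr x N"
    and ctr_mult: "ctr x (M * N) = ctr x M * N + hat M * ctr x N"
begin

lemma additive_ip_left: "additive (\<lambda>L. ip L N)"
  by standard (rule ip_add_left)

lemma additive_ip_right: "additive (ip L)"
  by standard (rule ip_add_right)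

lemma additive_hat: "additive hat"
  by standard (rule hat_add)

lemma additive_ctr: "additive (ctr x)"
  by standard (rule ctr_add)

lemma eqI:
  assumes "\<And>L. ip L M = ip L N"
  shows "M = N"
proof -
  have "ip L (M - N) = 0" for L
    by (simp add: additive.diff[OF additive_ip_right] assms)
  then show ?thesis using nondegenerate[of "M - N"] by simp
qed

abbreviation lc :: "'e \<Rightarrow> 'e \<Rightarrow> 'e" where "lc \<equiv> left_contraction ip"
abbreviation rc :: "'e \<Rightarrow> 'e \<Rightarrow> 'e" where "rc \<equiv> right_contraction ip"

lemma lc_eqI:
  assumes "\<And>L. ip L P = ip (M * L) N"
  shows "lc M N = P"
  unfolding left_contraction_def using assms by (intro the_equality) (auto intro: eqI)

lemma ip_lc: "ip L (lc M N) = ip (M * L) N"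
proof -
  obtain P where "\<forall>L. ip L P = ip (M * L) N" using adjoint_exists by blast
  then show ?thesis using lc_eqI[of P M N] by simp
qed

lemma rc_eqI:
  assumes "\<And>L. ip L P = ip (L * M) N"
  shows "rc N M = P"
  unfolding right_contraction_def using assms by (intro the_equality) (auto intro: eqI)

lemma additive_lc_left: "additive (\<lambda>M. lc M N)"
  by standard (auto intro!: lc_eqI simp: ip_add_right ip_lc distrib_right ip_add_left)

lemma lc_one: "lc 1 N = N"
  by (rule lc_eqI) simp

lemma rc_one: "rc N 1 = N"
  by (rule rc_eqI) simp

lemma lc_mult_emb: "lc (M * emb x) N = ctr x (lc M N)"
  by (rule lc_eqI) (simp add: ip_ctr ip_lc mult.assoc)

text \<open>Right contraction by a vector \<open>x\<close> is \<open>\<delta>\<^sub>x\<close> followed by the grade involution, because \<open>L\<close> and \<open>x\<close>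
commute up to the involution of \<open>L\<close>.\<close>

lemma ip_hat_ctr: "ip L (hat (ctr x N)) = ip (L * emb x) N"
proof -
  have "ip L (hat (ctr x N)) = ip (emb x * hat L) N"
    by (simp add: ip_ctr flip: ip_hat)
  then show ?thesis by (simp add: emb_commute hat_hat)
qed

lemma blade_Nil: "blade emb v [] = 1"
  by (simp add: blade_def)

lemma blade_snoc: "blade emb v (i @ [n]) = blade emb v i * emb (v n)"
  by (simp add: blade_def)

text \<open>Right contractions by blades exist because those by vectors can be iterated.\<close>

lemma ip_rc_blade: "ip L (rc N (blade emb v i)) = ip (L * blade emb v i) N"
proof -
  have "\<exists>P. \<forall>L. ip L P = ip (L * blade emb v i) N"
  proof (induction i arbitrary: N rule: rev_induct)
    case Nil
    show ?case by (auto simp: blade_Nil)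
  next
    case (snoc n i)
    from snoc[of "hat (ctr (v n) N)"] show ?case
      by (simp add: blade_snoc ip_hat_ctr mult.assoc)
  qed
  then obtain P where "\<forall>L. ip L P = ip (L * blade emb v i) N" by blast
  then show ?thesis using rc_eqI[of P "blade emb v i" N] by simp
qed

lemma additive_rc_blade: "additive (\<lambda>N. rc N (blade emb v i))"
  by standard (auto intro!: rc_eqI simp: ip_add_right ip_rc_blade)

lemma rc_blade_snoc: "rc N (blade emb v (i @ [n])) = rc (hat (ctr (v n) N)) (blade emb v i)"
  by (rule rc_eqI) (simp add: ip_rc_blade ip_hat_ctr blade_snoc mult.assoc)

text \<open>Contraction lowers the grade by one, so it anticommutes with the grade involution. Instead of grades,
the proof compares adjoints.\<close>

lemma hat_ctr: "hat (ctr x N) = - ctr x (hat N)"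
proof (rule eqI)
  fix L
  have "ip L (hat (ctr x N)) = ip (emb x * hat L) N"
    by (simp add: ip_ctr flip: ip_hat)
  also have "emb x * hat L = - hat (emb x * L)"
    by (simp add: hat_mult hat_emb)
  also have "ip \<dots> N = - ip L (ctr x (hat N))"
    by (simp add: additive.minus[OF additive_ip_left] ip_hat ip_ctr)
  finally show "ip L (hat (ctr x N)) = ip L (- ctr x (hat N))"
    by (simp add: additive.minus[OF additive_ip_right])
qed

lemma hat_lc_blade: "hat (lc (blade emb v i) N) = (- 1) ^ length i * lc (blade emb v i) (hat N)"
  by (induction i rule: rev_induct)
    (simp_all add: blade_Nil lc_one blade_snoc lc_mult_emb hat_ctr
      additive_power_neg_one_mult[OF additive_ctr])

lemma hat_pow_ctr: "(hat ^^ n) (hat (ctr x N)) = (- 1) ^ n * hat (ctr x ((hat ^^ n) N))"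
  by (induction n)
    (simp_all add: additive_power_neg_one_mult[OF additive_hat] hat_ctr hat_hat
      additive.minus[OF additive_hat] additive.minus[OF additive_ctr])

text \<open>In the induction step, \<open>?T i\<close> is the part in which the new vector contracts \<open>M\<close>, and
\<open>?T (i @ [Suc p])\<close> the part in which it contracts \<open>N\<close>.\<close>

theorem lc_blade_mult:
  "lc (blade emb v [1..<Suc p]) (M * N) =
    (\<Sum>i\<in>multi_indices p. of_int (sorting_sign (i @ co_index p i)) *
      (lc (blade emb v (co_index p i)) ((hat ^^ length i) M) * lc (blade emb v i) N))"
proof (induction p)
  case 0
  have "co_index 0 [] = []" by (simp add: co_index_def)
  moreover have "sorting_sign [] = 1"
    using sorting_sign_eq_sign[of "[]" id] by (simp add: permute_list_def)
  ultimately show ?case by (simp add: multi_indices_0 blade_Nil lc_one)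
next
  case (Suc p)
  let ?x = "v (Suc p)"
  let ?s = "\<lambda>i. of_int (sorting_sign (i @ co_index p i)) :: 'e"
  let ?A = "\<lambda>i. lc (blade emb v (co_index p i)) ((hat ^^ length i) M)"
  let ?B = "\<lambda>i. lc (blade emb v i) N"
  let ?T = "\<lambda>i. of_int (sorting_sign (i @ co_index (Suc p) i)) *
    (lc (blade emb v (co_index (Suc p) i)) ((hat ^^ length i) M) * lc (blade emb v i) N)"
  have split: "ctr ?x (?s i * (?A i * ?B i)) = ?T i + ?T (i @ [Suc p])"
    if i: "i \<in> multi_indices p" for i
  proof -
    have "ctr ?x (?s i * (?A i * ?B i)) =
        ?s i * (ctr ?x (?A i) * ?B i) + ?s i * (hat (?A i) * ctr ?x (?B i))"
      by (subst additive_of_int_mult[OF additive_ctr]) (simp add: ctr_mult distrib_left)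
    also have "?s i * (hat (?A i) * ctr ?x (?B i)) =
        of_int ((- 1) ^ length (co_index p i) * sorting_sign (i @ co_index p i)) *
          (lc (blade emb v (co_index p i)) ((hat ^^ Suc (length i)) M) * ctr ?x (?B i))"
      by (simp add: hat_lc_blade mult.assoc power_neg_one_commute[of _ "?s i"])
    finally show ?thesis
      unfolding sorting_sign_co_index_Suc[OF i] sorting_sign_co_index_Suc_snoc[OF i]
      by (simp add: co_index_Suc[OF i] co_index_Suc_snoc[OF i] blade_snoc lc_mult_emb)
  qed
  have "lc (blade emb v [1..<Suc (Suc p)]) (M * N) =
      ctr ?x (lc (blade emb v [1..<Suc p]) (M * N))"
    by (simp add: blade_snoc lc_mult_emb)
  also have "\<dots> = (\<Sum>i\<in>multi_indices p. ctr ?x (?s i * (?A i * ?B i)))"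
    unfolding Suc by (rule additive.sum[OF additive_ctr])
  also have "\<dots> = (\<Sum>i\<in>multi_indices p. ?T i + ?T (i @ [Suc p]))"
    by (intro sum.cong refl split)
  finally show ?case
    unfolding sum_multi_indices_Suc sum.distrib .
qed

text \<open>The Leibniz rule read through adjoints: applied to \<open>hat M * L\<close>, it expresses
\<open>M * ctr x L\<close>, whose inner product with \<open>N\<close> is that of \<open>L\<close> with the left-hand side.\<close>

lemma emb_mult_lc: "emb x * lc M N = lc (hat (ctr x M)) N + lc (hat M) (emb x * N)"
proof (rule eqI)
  fix L
  have "ip L (lc (hat M) (emb x * N)) = ip (ctr x (hat M * L)) N"
    by (simp add: ip_lc ip_emb_mult)
  also have "ctr x (hat M * L) = M * ctr x L - hat (ctr x M) * L"
    by (simp add: ctr_mult hat_hat hat_ctr)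
  also have "ip \<dots> N = ip L (emb x * lc M N) - ip L (lc (hat (ctr x M)) N)"
    by (simp add: additive.diff[OF additive_ip_left] ip_lc ip_emb_mult)
  finally show "ip L (emb x * lc M N) =
      ip L (lc (hat (ctr x M)) N + lc (hat M) (emb x * N))"
    by (simp add: ip_add_right)
qed

text \<open>The last vector is multiplied in first, which changes both arguments of the contraction; the
induction therefore runs over all \<open>M\<close> and \<open>N\<close>.\<close>

theorem blade_mult_lc:
  "blade emb v [1..<Suc p] * lc M N =
    (\<Sum>i\<in>multi_indices p. of_int (sorting_sign (i @ co_index p i)) *
      lc (rc ((hat ^^ length (co_index p i)) M) (blade emb v i)) (blade emb v (co_index p i) * N))"
proof (induction p arbitrary: M N)
  case 0
  have "co_index 0 [] = []" by (simp add: co_index_def)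
  moreover have "sorting_sign [] = 1"
    using sorting_sign_eq_sign[of "[]" id] by (simp add: permute_list_def)
  ultimately show ?case by (simp add: multi_indices_0 blade_Nil rc_one)
next
  case (Suc p)
  let ?x = "v (Suc p)"
  let ?S = "\<lambda>M N i. of_int (sorting_sign (i @ co_index p i)) *
    lc (rc ((hat ^^ length (co_index p i)) M) (blade emb v i)) (blade emb v (co_index p i) * N)"
  let ?T = "\<lambda>i. of_int (sorting_sign (i @ co_index (Suc p) i)) *
    lc (rc ((hat ^^ length (co_index (Suc p) i)) M) (blade emb v i))
      (blade emb v (co_index (Suc p) i) * N)"
  have keep: "?S (hat M) (emb ?x * N) i = ?T i" if i: "i \<in> multi_indices p" for i
    unfolding sorting_sign_co_index_Suc[OF i] unfolding co_index_Suc[OF i]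
    by (simp add: blade_snoc mult.assoc funpow_swap1)
  have extend: "?S (hat (ctr ?x M)) N i = ?T (i @ [Suc p])" if i: "i \<in> multi_indices p" for i
    unfolding sorting_sign_co_index_Suc_snoc[OF i] unfolding co_index_Suc_snoc[OF i]
    by (simp add: rc_blade_snoc hat_pow_ctr additive_power_neg_one_mult[OF additive_rc_blade]
        additive_power_neg_one_mult[OF additive_lc_left] mult.assoc
        power_neg_one_commute[of _ "of_int _"])
  have "blade emb v [1..<Suc (Suc p)] * lc M N =
      blade emb v [1..<Suc p] * (emb ?x * lc M N)"
    by (simp add: blade_snoc mult.assoc)
  also have "\<dots> = blade emb v [1..<Suc p] * lc (hat M) (emb ?x * N) +
      blade emb v [1..<Suc p] * lc (hat (ctr ?x M)) N"
    by (simp add: emb_mult_lc distrib_left)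
  also have "\<dots> = (\<Sum>i\<in>multi_indices p. ?T i) + (\<Sum>i\<in>multi_indices p. ?T (i @ [Suc p]))"
    unfolding Suc.IH by (intro arg_cong2[where f = "(+)"] sum.cong refl keep extend)
  finally show ?case
    unfolding sum_multi_indices_Suc .
qed

end

section \<open>The exterior algebras of Euclidean and Hermitian spaces\<close>

interpretation real_anisotropic: anisotropic_form "scaleR :: _ \<Rightarrow> 'a::fin_dim_real_inner \<Rightarrow> 'a" inner id
proof
  show "\<exists>B. finite B \<and> (\<forall>x::'a. \<exists>c. x = (\<Sum>b\<in>B. scaleR (c b) b))"
    by (rule real_fin_dim)
  show "inner x x \<noteq> 0" if "x \<noteq> 0" for x :: 'a
    using that by simp
qed

lift_definition real_ext_contraction :: "'a::real_inner \<Rightarrow> 'a real_ext \<Rightarrow> 'a real_ext"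
  is "real_sesquilinear.free_contraction"
  by (rule real_sesquilinear.free_contraction_ext_eq)

interpretation real_exterior: exterior_contraction
  "real_ext_inner :: 'a::fin_dim_real_inner real_ext \<Rightarrow> _" real_ext_involution real_ext_vec real_ext_contraction
proof
  fix K L M N :: "'a real_ext" and x :: 'a
  show "real_ext_inner (K + L) N = real_ext_inner K N + real_ext_inner L N"
    by transfer (rule real_sesquilinear.gram_add_left)
  show "real_ext_inner L (M + N) = real_ext_inner L M + real_ext_inner L N"
    by transfer (rule real_sesquilinear.gram_add_right)
  show "N = 0" if "\<And>L. real_ext_inner L N = 0"
    using that by transfer (simp add: ext_eq_def real_anisotropic.gram_nondegenerate)
  show "\<exists>P. \<forall>L. real_ext_inner L P = real_ext_inner (M * L) N"
    by transfer (rule real_sesquilinear.gram_adjoint_exists)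
  show "real_ext_involution (M + N) = real_ext_involution M + real_ext_involution N"
    by transfer (simp add: word_involution_add ext_eq_refl)
  show "real_ext_involution (M * N) = real_ext_involution M * real_ext_involution N"
    by (rule real_ext_involution_mult)
  show "real_ext_involution (real_ext_involution M) = M"
    by transfer (simp add: word_involution_involution ext_eq_refl)
  show "real_ext_involution (real_ext_vec x) = - real_ext_vec x"
    by transfer (simp add: word_involution_single single_uminus ext_eq_refl)
  show "real_ext_inner (real_ext_involution L) N = real_ext_inner L (real_ext_involution N)"
    by transfer (rule real_sesquilinear.gram_word_involution)
  show "real_ext_vec x * L = real_ext_involution L * real_ext_vec x"
    by transfer (rule ext_eq_letter_commute)
  show "real_ext_inner L (real_ext_contraction x N) = real_ext_inner (real_ext_vec x * L) N"
    by transfer (rule real_sesquilinear.gram_free_contraction)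
  show "real_ext_inner L (real_ext_vec x * N) = real_ext_inner (real_ext_contraction x L) N"
    by transfer (rule real_sesquilinear.gram_letter_mult)
  show "real_ext_contraction x (M + N) = real_ext_contraction x M + real_ext_contraction x N"
    by transfer (simp add: real_sesquilinear.free_contraction_add ext_eq_refl)
  show "real_ext_contraction x (M * N) =
      real_ext_contraction x M * N + real_ext_involution M * real_ext_contraction x N"
    by transfer (simp add: real_sesquilinear.free_contraction_mult ext_eq_refl)
qed

interpretation complex_anisotropic: anisotropic_form "scaleC :: _ \<Rightarrow> 'a::hermitian_space \<Rightarrow> 'a" cinner cnj
proof
  show "\<exists>B. finite B \<and> (\<forall>x::'a. \<exists>c. x = (\<Sum>b\<in>B. scaleC (c b) b))"
    by (rule complex_fin_dim)
  show "cinner x x \<noteq> 0" if "x \<noteq> 0" for x :: 'a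
    using cinner_pos[OF that] by auto
qed (simp_all add: scaleC_add_right scaleC_add_left scaleC_scaleC scaleC_one)

lift_definition complex_ext_contraction :: "'a::hermitian_space \<Rightarrow> 'a complex_ext \<Rightarrow> 'a complex_ext"
  is "complex_sesquilinear.free_contraction"
  by (rule complex_sesquilinear.free_contraction_ext_eq)

interpretation complex_exterior: exterior_contraction
  "complex_ext_inner :: 'a::hermitian_space complex_ext \<Rightarrow> _" complex_ext_involution complex_ext_vec complex_ext_contraction
proof
  fix K L M N :: "'a complex_ext" and x :: 'a
  show "complex_ext_inner (K + L) N = complex_ext_inner K N + complex_ext_inner L N"
    by transfer (rule complex_sesquilinear.gram_add_left)
  show "complex_ext_inner L (M + N) = complex_ext_inner L M + complex_ext_inner L N"
    by transfer (rule complex_sesquilinear.gram_add_right)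
  show "N = 0" if "\<And>L. complex_ext_inner L N = 0"
    using that by transfer (simp add: ext_eq_def complex_anisotropic.gram_nondegenerate)
  show "\<exists>P. \<forall>L. complex_ext_inner L P = complex_ext_inner (M * L) N"
    by transfer (rule complex_sesquilinear.gram_adjoint_exists)
  show "complex_ext_involution (M + N) = complex_ext_involution M + complex_ext_involution N"
    by transfer (simp add: word_involution_add ext_eq_refl)
  show "complex_ext_involution (M * N) = complex_ext_involution M * complex_ext_involution N"
    by (rule complex_ext_involution_mult)
  show "complex_ext_involution (complex_ext_involution M) = M"
    by transfer (simp add: word_involution_involution ext_eq_refl)
  show "complex_ext_involution (complex_ext_vec x) = - complex_ext_vec x"
    by transfer (simp add: word_involution_single single_uminus ext_eq_refl)
  show "complex_ext_inner (complex_ext_involution L) N = complex_ext_inner L (complex_ext_involution N)"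
    by transfer (rule complex_sesquilinear.gram_word_involution)
  show "complex_ext_vec x * L = complex_ext_involution L * complex_ext_vec x"
    by transfer (rule ext_eq_letter_commute)
  show "complex_ext_inner L (complex_ext_contraction x N) = complex_ext_inner (complex_ext_vec x * L) N"
    by transfer (rule complex_sesquilinear.gram_free_contraction)
  show "complex_ext_inner L (complex_ext_vec x * N) = complex_ext_inner (complex_ext_contraction x L) N"
    by transfer (rule complex_sesquilinear.gram_letter_mult)
  show "complex_ext_contraction x (M + N) = complex_ext_contraction x M + complex_ext_contraction x N"
    by transfer (simp add: complex_sesquilinear.free_contraction_add ext_eq_refl)
  show "complex_ext_contraction x (M * N) =
      complex_ext_contraction x M * N + complex_ext_involution M * complex_ext_contraction x N"
    by transfer (simp add: complex_sesquilinear.free_contraction_mult ext_eq_refl)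
qed

theorem theorem3p35:
  fixes p :: nat
    and v :: "nat \<Rightarrow> 'a::fin_dim_real_inner" and M N :: "'a real_ext"
    and w :: "nat \<Rightarrow> 'b::hermitian_space" and P Q :: "'b complex_ext"
  shows
   "(left_contraction real_ext_inner (blade real_ext_vec v [1..<Suc p]) (M * N) =
      (\<Sum>i\<in>multi_indices p. of_int (sorting_sign (i @ co_index p i)) *
        (left_contraction real_ext_inner
           (blade real_ext_vec v (co_index p i))
           ((real_ext_involution ^^ length i) M) *
         left_contraction real_ext_inner (blade real_ext_vec v i) N)))
    \<and>
    (blade real_ext_vec v [1..<Suc p] * left_contraction real_ext_inner M N =
      (\<Sum>i\<in>multi_indices p. of_int (sorting_sign (i @ co_index p i)) *
        left_contraction real_ext_inner
          (right_contraction real_ext_inner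
             ((real_ext_involution ^^ length (co_index p i)) M)
             (blade real_ext_vec v i))
          (blade real_ext_vec v (co_index p i) * N)))
    \<and>
    (left_contraction complex_ext_inner (blade complex_ext_vec w [1..<Suc p]) (P * Q) =
      (\<Sum>i\<in>multi_indices p. of_int (sorting_sign (i @ co_index p i)) *
        (left_contraction complex_ext_inner
           (blade complex_ext_vec w (co_index p i))
           ((complex_ext_involution ^^ length i) P) *
         left_contraction complex_ext_inner (blade complex_ext_vec w i) Q)))
    \<and>
    (blade complex_ext_vec w [1..<Suc p] * left_contraction complex_ext_inner P Q =
      (\<Sum>i\<in>multi_indices p. of_int (sorting_sign (i @ co_index p i)) *
        left_contraction complex_ext_inner
          (right_contraction complex_ext_inner
             ((complex_ext_involution ^^ length (co_index p i)) P)
             (blade complex_ext_vec w i))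
          (blade complex_ext_vec w (co_index p i) * Q)))"
  by (intro conjI real_exterior.lc_blade_mult real_exterior.blade_mult_lc
      complex_exterior.lc_blade_mult complex_exterior.blade_mult_lc)

end
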